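(* Let $(M^{2n+1},\theta,\xi,\eta,g)$ be a nearly cosymplectic manifold. Then the unit vector field $\xi$ is harmonic as a unit vector field, i.e. $\nabla^*\nabla\xi=|\nabla\xi|^2\xi$. Furthermore $$\sum_{i=1}^{2n}R^{\mathcal F}(F_i,\theta F_i)\xi=0,$$ where $\{F_i\}_{i=1,\dots,2n}$ is an orthonormal frame of $\mathcal F$, and the second harmonic section equation $$\nabla^*\nabla\xi=|\nabla\xi|^2\,\xi-\tfrac12\,J\Big(\sum_{i=1}^{2n+1}(\bar\nabla_{E_i}J)(\nabla_{E_i}\xi)\Big)$$ is satisfied, where $\{E_i\}_{i=1,\dots,2n+1}=\{F_i\}_{i=1,\dots,2n}\cup\{\xi\}$.
   Context: An almost contact (metric) structure on a Riemannian manifold $(M^{2n+1},g)$ consists of a $(1,1)$-tensor $\theta$, a 1-form $\eta$ and a unit vector field $\xi$ with $\theta^2=-\mathrm{Id}+\eta\otimes\xi$, $\eta(\xi)=1$, compatible with the metric: $g(\theta X,\theta Y)=g(X,Y)-\eta(X)\eta(Y)$ (so $\eta=g(\xi,\cdot)$, $\theta\xi=0$ and $\theta$ is skew-symmetric). It is nearly cosymplectic, and $(M,\theta,\xi,\eta,g)$ is a nearly cosymplectic manifold, if $(\nabla_X\theta)(Y)+(\nabla_Y\theta)(X)=0$ for all $X,Y$, where $\nabla$ is the Levi-Civita connection of $g$. $\mathcal F$ is the distribution orthogonal to $\xi$ (rank $2n$), $J$ is the restriction of $\theta$ to $\mathcal F$, and $\bar\nabla$ is the connection on $\mathcal F$ obtained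 by projecting $\nabla$ orthogonally onto $\mathcal F$; $(\bar\nabla_XJ)(Y)=\bar\nabla_X(JY)-J\bar\nabla_XY$ for $X\in TM$ and $Y$ a section of $\mathcal F$. $\nabla^2_{X,Y}=\nabla_X\nabla_Y-\nabla_{\nabla_XY}$, $\nabla^*\nabla=-\mathrm{trace}\,\nabla^2$, and $|\nabla\xi|^2=\sum_i|\nabla_{E_i}\xi|^2$. The curvature is $R(X,Y)=[\nabla_X,\nabla_Y]-\nabla_{[X,Y]}$, and $R^{\mathcal F}(X,Y)Z$ denotes the orthogonal projection of $R(X,Y)Z$ onto $\mathcal F$. *)

theory Defs
  imports "HOL-Analysis.Analysis" "HOL-Library.Function_Algebras"
begin

section \<open>Function spaces as real vector spaces\<close>

instantiation "fun" :: (type, real_vector) real_vector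
begin

definition scaleR_fun :: "real \<Rightarrow> ('a \<Rightarrow> 'b) \<Rightarrow> 'a \<Rightarrow> 'b"
  where "scaleR_fun c f = (\<lambda>x. c *\<^sub>R f x)"

instance
  by standard (auto simp: scaleR_fun_def fun_eq_iff scaleR_add_right scaleR_add_left)

end

section \<open>Smooth manifolds\<close>

primrec Ck_on :: "nat \<Rightarrow> 'e::euclidean_space set \<Rightarrow> ('e \<Rightarrow> 'f::real_normed_vector) \<Rightarrow> bool"
  where
    "Ck_on 0 S f \<longleftrightarrow> continuous_on S f"
  | "Ck_on (Suc k) S f \<longleftrightarrow>
      (\<forall>x\<in>S. f differentiable (at x)) \<and>
      (\<forall>v. Ck_on k S (\<lambda>x. frechet_derivative f (at x) v))"

definition smooth_on :: "'e::euclidean_space set \<Rightarrow> ('e \<Rightarrow> 'f::real_normed_vector) \<Rightarrow> bool"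
  where "smooth_on S f \<longleftrightarrow> open S \<and> (\<forall>k. Ck_on k S f)"

type_synonym ('a, 'e) atlas = "('a set \<times> ('a \<Rightarrow> 'e)) set"

text \<open>
  The manifold is the whole type \<open>'a\<close>, its dimension is \<open>DIM('e)\<close>, and the smooth structure is
  given by an atlas that need not be maximal.
\<close>

definition smooth_manifold ::
    "('a::{t2_space,second_countable_topology}, 'e::euclidean_space) atlas \<Rightarrow> bool"
  where "smooth_manifold A \<longleftrightarrow>
    (\<Union>(U, \<phi>)\<in>A. U) = UNIV \<and>
    (\<forall>(U, \<phi>)\<in>A. open U \<and> open (\<phi> ` U) \<and> homeomorphism U (\<phi> ` U) \<phi> (inv_into U \<phi>)) \<and>
    (\<forall>(U, \<phi>)\<in>A. \<forall>(V, \<psi>)\<in>A. smooth_on (\<phi> ` (U \<inter> V)) (\<psi> \<circ> inv_into U \<phi>))"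

definition smooth_fun ::
    "('a::topological_space, 'e::euclidean_space) atlas \<Rightarrow> 'a set \<Rightarrow> ('a \<Rightarrow> real) \<Rightarrow> bool"
  where "smooth_fun A W f \<longleftrightarrow>
    open W \<and> (\<forall>(U, \<phi>)\<in>A. smooth_on (\<phi> ` (U \<inter> W)) (f \<circ> inv_into U \<phi>))"

definition smooth_at ::
    "('a::topological_space, 'e::euclidean_space) atlas \<Rightarrow> 'a \<Rightarrow> ('a \<Rightarrow> real) \<Rightarrow> bool"
  where "smooth_at A p f \<longleftrightarrow> (\<exists>W. p \<in> W \<and> smooth_fun A W f)"

type_synonym 'a tvec = "('a \<Rightarrow> real) \<Rightarrow> real"
type_synonym 'a vfield = "'a \<Rightarrow> 'a tvec"

text \<open>
  Tangent vectors at \<open>p\<close> are the derivations of the germs of smooth functions at \<open>p\<close>. Locality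
  is automatic: if \<open>f\<close> vanishes near \<open>p\<close>, then \<open>f = \<chi> f\<close> for some \<open>\<chi>\<close> vanishing near \<open>p\<close> and equal
  to \<open>1\<close> elsewhere, which is smooth at \<open>p\<close>, so the Leibniz rule gives \<open>v f = 0\<close>. The last clause
  fixes the value on functions that have no smooth germ at \<open>p\<close>.
\<close>

definition tangent_space ::
    "('a::topological_space, 'e::euclidean_space) atlas \<Rightarrow> 'a \<Rightarrow> 'a tvec set"
  where "tangent_space A p = {v.
    (\<forall>f h. smooth_at A p f \<longrightarrow> smooth_at A p h \<longrightarrow>
      v (\<lambda>x. f x + h x) = v f + v h \<and>
      v (\<lambda>x. f x * h x) = f p * v h + h p * v f) \<and>
    (\<forall>c f. smooth_at A p f \<longrightarrow> v (\<lambda>x. c * f x) = c * v f) \<and>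
    (\<forall>f. \<not> smooth_at A p f \<longrightarrow> v f = 0)}"

text \<open>
  Local sections over an open set \<open>U\<close> are represented by total functions whose values off \<open>U\<close> are
  irrelevant.
\<close>

definition vfields ::
    "('a::topological_space, 'e::euclidean_space) atlas \<Rightarrow> 'a set \<Rightarrow> 'a vfield set"
  where "vfields A U = {X.
    (\<forall>p\<in>U. X p \<in> tangent_space A p) \<and>
    (\<forall>W f. W \<subseteq> U \<longrightarrow> smooth_fun A W f \<longrightarrow> smooth_fun A W (\<lambda>p. X p f))}"

definition lie_bracket ::
    "('a::topological_space, 'e::euclidean_space) atlas \<Rightarrow> 'a vfield \<Rightarrow> 'a vfield \<Rightarrow> 'a vfield"
  where "lie_bracket A X Y = (\<lambda>p f.
    if smooth_at A p f then X p (\<lambda>q. Y q f) - Y p (\<lambda>q. X q f) else 0)"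

section \<open>Tensor fields and Riemannian metrics\<close>

definition lin_on :: "'v::real_vector set \<Rightarrow> ('v \<Rightarrow> 'w::real_vector) \<Rightarrow> bool"
  where "lin_on V L \<longleftrightarrow>
    (\<forall>u\<in>V. \<forall>v\<in>V. L (u + v) = L u + L v) \<and> (\<forall>c. \<forall>v\<in>V. L (c *\<^sub>R v) = c *\<^sub>R L v)"

type_synonym 'a metric = "'a \<Rightarrow> 'a tvec \<Rightarrow> 'a tvec \<Rightarrow> real"

definition riemannian_metric ::
    "('a::topological_space, 'e::euclidean_space) atlas \<Rightarrow> 'a metric \<Rightarrow> bool"
  where "riemannian_metric A g \<longleftrightarrow>
    (\<forall>p. \<forall>u\<in>tangent_space A p.
      lin_on (tangent_space A p) (g p u) \<and>
      (\<forall>v\<in>tangent_space A p. g p u v = g p v u) \<and>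
      (u \<noteq> 0 \<longrightarrow> g p u u > 0)) \<and>
    (\<forall>U. open U \<longrightarrow> (\<forall>X\<in>vfields A U. \<forall>Y\<in>vfields A U.
      smooth_fun A U (\<lambda>p. g p (X p) (Y p))))"

definition one_form ::
    "('a::topological_space, 'e::euclidean_space) atlas \<Rightarrow> ('a \<Rightarrow> 'a tvec \<Rightarrow> real) \<Rightarrow> bool"
  where "one_form A \<eta> \<longleftrightarrow>
    (\<forall>p. lin_on (tangent_space A p) (\<eta> p)) \<and>
    (\<forall>U. open U \<longrightarrow> (\<forall>X\<in>vfields A U. smooth_fun A U (\<lambda>p. \<eta> p (X p))))"

definition tensor_1_1 ::
    "('a::topological_space, 'e::euclidean_space) atlas \<Rightarrow> ('a \<Rightarrow> 'a tvec \<Rightarrow> 'a tvec) \<Rightarrow> bool"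
  where "tensor_1_1 A \<theta> \<longleftrightarrow>
    (\<forall>p. lin_on (tangent_space A p) (\<theta> p)) \<and>
    (\<forall>p. \<forall>v\<in>tangent_space A p. \<theta> p v \<in> tangent_space A p) \<and>
    (\<forall>U. open U \<longrightarrow> (\<forall>X\<in>vfields A U. (\<lambda>p. \<theta> p (X p)) \<in> vfields A U))"

section \<open>Connections and curvature\<close>

type_synonym 'a connection = "'a vfield \<Rightarrow> 'a vfield \<Rightarrow> 'a vfield"

text \<open>
  Connections act on vector fields over arbitrary open sets, so that they apply to local frames.
  That \<open>nabla X Y\<close> on \<open>U\<close> depends only on \<open>X\<close> and \<open>Y\<close> on \<open>U\<close> follows as for tangent vectors, because
  the axioms below hold for total functions that are only required to be smooth on \<open>U\<close>.
\<close>

definition affine_connection ::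
    "('a::topological_space, 'e::euclidean_space) atlas \<Rightarrow> 'a connection \<Rightarrow> bool"
  where "affine_connection A nabla \<longleftrightarrow>
    (\<forall>U. open U \<longrightarrow> (\<forall>X\<in>vfields A U. \<forall>Y\<in>vfields A U.
      nabla X Y \<in> vfields A U \<and>
      (\<forall>Z\<in>vfields A U. \<forall>p\<in>U.
        nabla (X + Z) Y p = nabla X Y p + nabla Z Y p \<and>
        nabla X (Y + Z) p = nabla X Y p + nabla X Z p) \<and>
      (\<forall>f. smooth_fun A U f \<longrightarrow> (\<forall>p\<in>U.
        nabla (\<lambda>q. f q *\<^sub>R X q) Y p = f p *\<^sub>R nabla X Y p \<and>
        nabla X (\<lambda>q. f q *\<^sub>R Y q) p = X p f *\<^sub>R Y p + f p *\<^sub>R nabla X Y p))))"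

definition levi_civita ::
    "('a::topological_space, 'e::euclidean_space) atlas \<Rightarrow> 'a metric \<Rightarrow> 'a connection \<Rightarrow> bool"
  where "levi_civita A g nabla \<longleftrightarrow>
    affine_connection A nabla \<and>
    (\<forall>U. open U \<longrightarrow> (\<forall>X\<in>vfields A U. \<forall>Y\<in>vfields A U. \<forall>p\<in>U.
      nabla X Y p - nabla Y X p = lie_bracket A X Y p \<and>
      (\<forall>Z\<in>vfields A U.
        X p (\<lambda>q. g q (Y q) (Z q)) = g p (nabla X Y p) (Z p) + g p (Y p) (nabla X Z p))))"

definition curvature ::
    "('a::topological_space, 'e::euclidean_space) atlas \<Rightarrow> 'a connection \<Rightarrow>
      'a vfield \<Rightarrow> 'a vfield \<Rightarrow> 'a vfield \<Rightarrow> 'a vfield"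
  where "curvature A nabla X Y Z =
    nabla X (nabla Y Z) - nabla Y (nabla X Z) - nabla (lie_bracket A X Y) Z"

definition hessian :: "'a connection \<Rightarrow> 'a vfield \<Rightarrow> 'a vfield \<Rightarrow> 'a vfield \<Rightarrow> 'a vfield"
  where "hessian nabla X Y Z = nabla X (nabla Y Z) - nabla (nabla X Y) Z"

text \<open>A distribution is given by its fibres \<open>V p\<close>; frames are local, over the open set \<open>U\<close>.\<close>

definition orthonormal_frame ::
    "('a::topological_space, 'e::euclidean_space) atlas \<Rightarrow> 'a metric \<Rightarrow> ('a \<Rightarrow> 'a tvec set) \<Rightarrow>
      'a set \<Rightarrow> 'i set \<Rightarrow> ('i \<Rightarrow> 'a vfield) \<Rightarrow> bool"
  where "orthonormal_frame A g V U I E \<longleftrightarrow>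
    open U \<and> (\<forall>i\<in>I. E i \<in> vfields A U) \<and>
    (\<forall>p\<in>U. (\<forall>i\<in>I. \<forall>j\<in>I. g p (E i p) (E j p) = (if i = j then 1 else 0)) \<and>
      span ((\<lambda>i. E i p) ` I) = V p)"

text \<open>
  Traces with respect to \<open>g\<close> are computed in an orthonormal frame \<open>(E\<^sub>i)\<close> of the tangent bundle,
  which is passed as an argument.
\<close>

definition rough_laplacian ::
    "'a connection \<Rightarrow> 'i set \<Rightarrow> ('i \<Rightarrow> 'a vfield) \<Rightarrow> 'a vfield \<Rightarrow> 'a vfield"
  where "rough_laplacian nabla I E Z = - (\<Sum>i\<in>I. hessian nabla (E i) (E i) Z)"

definition sq_norm_nabla ::
    "'a metric \<Rightarrow> 'a connection \<Rightarrow> 'i set \<Rightarrow> ('i \<Rightarrow> 'a vfield) \<Rightarrow> 'a vfield \<Rightarrow> 'a \<Rightarrow> real"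
  where "sq_norm_nabla g nabla I E Z p = (\<Sum>i\<in>I. g p (nabla (E i) Z p) (nabla (E i) Z p))"

definition harmonic_unit_vector_field ::
    "('a::topological_space, 'e::euclidean_space) atlas \<Rightarrow> 'a metric \<Rightarrow> 'a connection \<Rightarrow>
      'a vfield \<Rightarrow> bool"
  where "harmonic_unit_vector_field A g nabla \<xi> \<longleftrightarrow>
    \<xi> \<in> vfields A UNIV \<and> (\<forall>p. g p (\<xi> p) (\<xi> p) = 1) \<and>
    (\<forall>U (E :: nat \<Rightarrow> 'a vfield).
      orthonormal_frame A g (tangent_space A) U {1..DIM('e)} E \<longrightarrow>
      (\<forall>p\<in>U. rough_laplacian nabla {1..DIM('e)} E \<xi> p =
        sq_norm_nabla g nabla {1..DIM('e)} E \<xi> p *\<^sub>R \<xi> p))"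

section \<open>Nearly cosymplectic manifolds\<close>

definition almost_contact_metric ::
    "('a::{t2_space,second_countable_topology}, 'e::euclidean_space) atlas \<Rightarrow>
      ('a \<Rightarrow> 'a tvec \<Rightarrow> 'a tvec) \<Rightarrow> 'a vfield \<Rightarrow> ('a \<Rightarrow> 'a tvec \<Rightarrow> real) \<Rightarrow> 'a metric \<Rightarrow> bool"
  where "almost_contact_metric A \<theta> \<xi> \<eta> g \<longleftrightarrow>
    smooth_manifold A \<and> riemannian_metric A g \<and>
    tensor_1_1 A \<theta> \<and> \<xi> \<in> vfields A UNIV \<and> one_form A \<eta> \<and>
    (\<forall>p. g p (\<xi> p) (\<xi> p) = 1 \<and> \<eta> p (\<xi> p) = 1 \<and>
      (\<forall>u\<in>tangent_space A p. \<theta> p (\<theta> p u) = - u + \<eta> p u *\<^sub>R \<xi> p \<and>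
        (\<forall>v\<in>tangent_space A p. g p (\<theta> p u) (\<theta> p v) = g p u v - \<eta> p u * \<eta> p v)))"

definition nabla_tensor ::
    "'a connection \<Rightarrow> ('a \<Rightarrow> 'a tvec \<Rightarrow> 'a tvec) \<Rightarrow> 'a vfield \<Rightarrow> 'a vfield \<Rightarrow> 'a vfield"
  where "nabla_tensor nabla \<theta> X Y = (\<lambda>p. nabla X (\<lambda>q. \<theta> q (Y q)) p - \<theta> p (nabla X Y p))"

definition nearly_cosymplectic ::
    "('a::{t2_space,second_countable_topology}, 'e::euclidean_space) atlas \<Rightarrow>
      ('a \<Rightarrow> 'a tvec \<Rightarrow> 'a tvec) \<Rightarrow> 'a vfield \<Rightarrow> ('a \<Rightarrow> 'a tvec \<Rightarrow> real) \<Rightarrow> 'a metric \<Rightarrow>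
      'a connection \<Rightarrow> bool"
  where "nearly_cosymplectic A \<theta> \<xi> \<eta> g nabla \<longleftrightarrow>
    almost_contact_metric A \<theta> \<xi> \<eta> g \<and> levi_civita A g nabla \<and>
    (\<forall>U. open U \<longrightarrow> (\<forall>X\<in>vfields A U. \<forall>Y\<in>vfields A U. \<forall>p\<in>U.
      nabla_tensor nabla \<theta> X Y p + nabla_tensor nabla \<theta> Y X p = 0))"

definition Fdist ::
    "('a::topological_space, 'e::euclidean_space) atlas \<Rightarrow> 'a metric \<Rightarrow> 'a vfield \<Rightarrow> 'a \<Rightarrow>
      'a tvec set"
  where "Fdist A g \<xi> p = {v \<in> tangent_space A p. g p (\<xi> p) v = 0}"

text \<open>The orthogonal projection onto \<open>Fdist\<close>, given that \<open>\<xi>\<close> has unit length.\<close>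

definition Fproj :: "'a metric \<Rightarrow> 'a vfield \<Rightarrow> 'a \<Rightarrow> 'a tvec \<Rightarrow> 'a tvec"
  where "Fproj g \<xi> p v = v - g p (\<xi> p) v *\<^sub>R \<xi> p"

definition Jrestr ::
    "('a::topological_space, 'e::euclidean_space) atlas \<Rightarrow> 'a metric \<Rightarrow> 'a vfield \<Rightarrow>
      ('a \<Rightarrow> 'a tvec \<Rightarrow> 'a tvec) \<Rightarrow> 'a \<Rightarrow> 'a tvec \<Rightarrow> 'a tvec"
  where "Jrestr A g \<xi> \<theta> p = restrict (\<theta> p) (Fdist A g \<xi> p)"

definition nabla_bar :: "'a metric \<Rightarrow> 'a vfield \<Rightarrow> 'a connection \<Rightarrow> 'a connection"
  where "nabla_bar g \<xi> nabla X Y = (\<lambda>p. Fproj g \<xi> p (nabla X Y p))"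

definition curvature_F ::
    "('a::topological_space, 'e::euclidean_space) atlas \<Rightarrow> 'a metric \<Rightarrow> 'a vfield \<Rightarrow>
      'a connection \<Rightarrow> 'a vfield \<Rightarrow> 'a vfield \<Rightarrow> 'a vfield \<Rightarrow> 'a vfield"
  where "curvature_F A g \<xi> nabla X Y Z = (\<lambda>p. Fproj g \<xi> p (curvature A nabla X Y Z p))"

end

theory Submission
  imports Defs
begin

text \<open>
  Write \<open>H = \<nabla>\<xi>\<close>, \<open>N = \<nabla>\<theta>\<close> and \<open>K = \<nabla>H = \<nabla>\<^sup>2\<xi>\<close>. The defining condition makes \<open>N\<close> totally skew; with
  \<open>\<theta>\<^sup>2 = -Id + \<eta> \<otimes> \<xi>\<close> it follows that \<open>H\<xi> = 0\<close>, that \<open>H\<close> anticommutes with \<open>\<theta>\<close> and that \<open>H\<close> is skew, so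
  \<open>\<xi>\<close> is Killing and \<open>R(\<xi>,Y)Z = -K(Y,Z)\<close>. The Ricci identity for \<open>\<theta>\<close> on \<open>(\<xi>,Y)\<close>, applied to \<open>Y\<close>, gives
  \<open>K(Y,\<theta>Y) = 2\<theta>K(Y,Y) + 2N(Y,HY)\<close>, while differentiating \<open>H\<theta> + \<theta>H = 0\<close> gives
  \<open>K(Y,\<theta>Y) = -\<theta>K(Y,Y) - N(Y,HY)\<close>. Hence \<open>K(Y,\<theta>Y) = 0\<close>, and replacing \<open>Y\<close> by \<open>\<theta>Y\<close> determines
  \<open>K(\<theta>Y,Y)\<close>. The cyclic symmetry of \<open>g(K(X,Y),Z)\<close> then yields \<open>N(Y,HY) = \<eta>(Y) H\<^sup>2\<theta>Y\<close> and
  \<open>K(Y,Y) = -|HY|\<^sup>2\<xi> - \<eta>(Y) H\<^sup>2Y\<close>. The trace of the last identity is harmonicity, and for \<open>Y\<close> orthogonal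
  to \<open>\<xi>\<close> the identities \<open>R(Y,\<theta>Y)\<xi> = 0\<close> and \<open>N(Y,HY) = 0\<close> make the other two sums vanish termwise.
\<close>

section \<open>Smooth functions\<close>

text \<open>Frechet derivatives at points of the open set \<open>S\<close> depend only on values in
  \<open>S\<close>, and the derivatives again agree on \<open>S\<close>, so the induction
  closes.\<close>

lemma Ck_on_cong:
  assumes "open S" "\<And>x. x \<in> S \<Longrightarrow> f x = h x" "Ck_on k S f"
  shows "Ck_on k S h"
  using assms(2,3)
proof (induction k arbitrary: f h)
  case 0
  then show ?case by (simp cong: continuous_on_cong)
next
  case (Suc k)
  have d: "f differentiable (at x)" if "x \<in> S" for x using Suc.prems that by simp
  have "h differentiable (at x)" if "x \<in> S" for x
    using d[OF that] Suc.prems(1) assms(1) that unfolding differentiable_def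
    by (meson has_derivative_transform_within_open)
  moreover have "Ck_on k S (\<lambda>x. frechet_derivative h (at x) v)" for v
  proof (rule Suc.IH)
    show "Ck_on k S (\<lambda>x. frechet_derivative f (at x) v)" using Suc.prems by simp
    show "frechet_derivative f (at x) v = frechet_derivative h (at x) v" if "x \<in> S" for x
      using frechet_derivative_transform_within_open[OF d[OF that] assms(1) that Suc.prems(1)]
      by simp
  qed
  ultimately show ?case by simp
qed

lemma Ck_on_SucD: "Ck_on (Suc k) S f \<Longrightarrow> Ck_on k S f"
proof (induction k arbitrary: f)
  case 0
  then show ?case
    by (auto intro!: continuous_at_imp_continuous_on differentiable_imp_continuous_within)
next
  case (Suc k)
  show ?case
    unfolding Ck_on.simps(2)[of k]
  proof (intro conjI allI)
    show "\<forall>x\<in>S. f differentiable at x" using Suc.prems by simp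
    show "Ck_on k S (\<lambda>x. frechet_derivative f (at x) v)" for v
      by (rule Suc.IH) (use Suc.prems in \<open>subst (asm) Ck_on.simps(2), blast\<close>)
  qed
qed

lemma Ck_on_subset: "Ck_on k S f \<Longrightarrow> T \<subseteq> S \<Longrightarrow> Ck_on k T f"
  by (induction k arbitrary: f) (auto intro: continuous_on_subset)

lemma Ck_on_const: "Ck_on k S (\<lambda>x. c)"
  by (induction k arbitrary: c) simp_all

lemma Ck_on_add:
  assumes "open S" "Ck_on k S f" "Ck_on k S h"
  shows "Ck_on k S (\<lambda>x. f x + h x)"
  using assms(2,3)
proof (induction k arbitrary: f h)
  case 0
  then show ?case by (simp add: continuous_on_add)
next
  case (Suc k)
  have "Ck_on k S (\<lambda>x. frechet_derivative (\<lambda>y. f y + h y) (at x) v)" for v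
  proof (rule Ck_on_cong[OF assms(1)])
    show "Ck_on k S (\<lambda>x. frechet_derivative f (at x) v + frechet_derivative h (at x) v)"
      using Suc by simp
    fix x assume "x \<in> S"
    then have "f differentiable (at x)" "h differentiable (at x)" using Suc.prems by simp_all
    then have "((\<lambda>y. f y + h y) has_derivative
        (\<lambda>v. frechet_derivative f (at x) v + frechet_derivative h (at x) v)) (at x)"
      by (intro has_derivative_add) (simp_all add: frechet_derivative_works[symmetric])
    then show "frechet_derivative f (at x) v + frechet_derivative h (at x) v
        = frechet_derivative (\<lambda>y. f y + h y) (at x) v"
      by (simp add: frechet_derivative_at[symmetric])
  qed
  then show ?case using Suc.prems by (simp add: differentiable_add)
qed

lemma Ck_on_mult:
  fixes f h :: "'e::euclidean_space \<Rightarrow> real"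
  assumes "open S" "Ck_on k S f" "Ck_on k S h"
  shows "Ck_on k S (\<lambda>x. f x * h x)"
  using assms(2,3)
proof (induction k arbitrary: f h)
  case 0
  then show ?case by (simp add: continuous_on_mult)
next
  case (Suc k)
  have "Ck_on k S (\<lambda>x. frechet_derivative (\<lambda>y. f y * h y) (at x) v)" for v
  proof (rule Ck_on_cong[OF assms(1)])
    show "Ck_on k S (\<lambda>x. f x * frechet_derivative h (at x) v + frechet_derivative f (at x) v * h x)"
      using Suc.prems
      by (intro Ck_on_add assms(1) Suc.IH) (auto intro: Ck_on_SucD)
    fix x assume "x \<in> S"
    then have "f differentiable (at x)" "h differentiable (at x)" using Suc.prems by simp_all
    then have "((\<lambda>y. f y * h y) has_derivative
        (\<lambda>v. f x * frechet_derivative h (at x) v + frechet_derivative f (at x) v * h x)) (at x)"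
      by (intro has_derivative_mult) (simp_all add: frechet_derivative_works[symmetric])
    then show "f x * frechet_derivative h (at x) v + frechet_derivative f (at x) v * h x
        = frechet_derivative (\<lambda>y. f y * h y) (at x) v"
      by (simp add: frechet_derivative_at[symmetric])
  qed
  then show ?case using Suc.prems by (simp add: differentiable_mult)
qed

section \<open>Smooth functions read in charts\<close>

lemma smooth_fun_open: "smooth_fun A W f \<Longrightarrow> open W"
  by (simp add: smooth_fun_def)

lemma open_chart_image:
  assumes "smooth_manifold A" "(V, \<phi>) \<in> A" "open W"
  shows "open (\<phi> ` (V \<inter> W))"
proof -
  have h: "open V" "open (\<phi> ` V)" "homeomorphism V (\<phi> ` V) \<phi> (inv_into V \<phi>)"
    using assms(1,2) unfolding smooth_manifold_def by blast+
  have "openin (top_of_set V) (V \<inter> W)" using assms(3) by (simp add: openin_open_Int)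
  then have "openin (top_of_set (\<phi> ` V)) (\<phi> ` (V \<inter> W))"
    using homeomorphism_imp_open_map[OF h(3)] by blast
  then show ?thesis using h(2) openin_open_trans by blast
qed

lemma smooth_fun_cong:
  assumes "smooth_manifold A" "smooth_fun A W f" "\<And>x. x \<in> W \<Longrightarrow> f x = h x"
  shows "smooth_fun A W h"
  unfolding smooth_fun_def
proof (intro conjI ballI, safe)
  show W: "open W" using assms(2) by (rule smooth_fun_open)
  fix V \<phi> assume V: "(V, \<phi>) \<in> A"
  have inj: "inj_on \<phi> V"
    using assms(1) V unfolding smooth_manifold_def homeomorphism_def
    by (auto intro!: inj_on_inverseI)
  have "Ck_on k (\<phi> ` (V \<inter> W)) (f \<circ> inv_into V \<phi>)" for k
    using assms(2) V unfolding smooth_fun_def smooth_on_def by fast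
  then have "Ck_on k (\<phi> ` (V \<inter> W)) (h \<circ> inv_into V \<phi>)" for k
    by (rule Ck_on_cong[OF open_chart_image[OF assms(1) V W], rotated])
      (use inj assms(3) in auto)
  then show "smooth_on (\<phi> ` (V \<inter> W)) (h \<circ> inv_into V \<phi>)"
    using open_chart_image[OF assms(1) V W] by (simp add: smooth_on_def)
qed

lemma smooth_fun_subset:
  assumes "smooth_manifold A" "smooth_fun A W f" "open T" "T \<subseteq> W"
  shows "smooth_fun A T f"
  unfolding smooth_fun_def smooth_on_def
proof (intro conjI ballI, fact, safe)
  fix V \<phi> assume V: "(V, \<phi>) \<in> A"
  show "open (\<phi> ` (V \<inter> T))" by (rule open_chart_image[OF assms(1) V assms(3)])
  fix k
  have "Ck_on k (\<phi> ` (V \<inter> W)) (f \<circ> inv_into V \<phi>)"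
    using assms(2) V unfolding smooth_fun_def smooth_on_def by fast
  then show "Ck_on k (\<phi> ` (V \<inter> T)) (f \<circ> inv_into V \<phi>)"
    by (rule Ck_on_subset) (use assms(4) in auto)
qed

lemma smooth_fun_const: "smooth_manifold A \<Longrightarrow> open W \<Longrightarrow> smooth_fun A W (\<lambda>x. c)"
  unfolding smooth_fun_def smooth_on_def
  by (auto simp: comp_def Ck_on_const open_chart_image)

lemma smooth_fun_add: "smooth_fun A W f \<Longrightarrow> smooth_fun A W h \<Longrightarrow> smooth_fun A W (\<lambda>x. f x + h x)"
  unfolding smooth_fun_def smooth_on_def
  by (fastforce simp: comp_def intro: Ck_on_add)

lemma smooth_fun_mult: "smooth_fun A W f \<Longrightarrow> smooth_fun A W h \<Longrightarrow> smooth_fun A W (\<lambda>x. f x * h x)"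
  unfolding smooth_fun_def smooth_on_def
  by (fastforce simp: comp_def intro: Ck_on_mult)

lemma smooth_fun_uminus:
  assumes "smooth_manifold A" "smooth_fun A W f"
  shows "smooth_fun A W (\<lambda>x. - f x)"
  using smooth_fun_mult[OF smooth_fun_const[OF assms(1) smooth_fun_open[OF assms(2)]] assms(2), of "-1"]
  by simp

lemma smooth_atI: "smooth_fun A W f \<Longrightarrow> p \<in> W \<Longrightarrow> smooth_at A p f"
  by (auto simp: smooth_at_def)

lemma smooth_at_common:
  assumes "smooth_manifold A" "smooth_at A p f" "smooth_at A p h" "open U" "p \<in> U"
  obtains W where "p \<in> W" "W \<subseteq> U" "smooth_fun A W f" "smooth_fun A W h"
proof -
  obtain S T where S: "p \<in> S" "smooth_fun A S f" and T: "p \<in> T" "smooth_fun A T h"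
    using assms(2,3) by (auto simp: smooth_at_def)
  have "open (S \<inter> T \<inter> U)" using S T assms smooth_fun_open by blast
  then show thesis
    using that[of "S \<inter> T \<inter> U"] S T assms smooth_fun_subset[OF assms(1)] by auto
qed

section \<open>Tangent vectors and vector fields\<close>

lemma tangent_spaceD:
  assumes "v \<in> tangent_space A p" "smooth_at A p f"
  shows "smooth_at A p h \<Longrightarrow> v (\<lambda>x. f x + h x) = v f + v h"
    and "smooth_at A p h \<Longrightarrow> v (\<lambda>x. f x * h x) = f p * v h + h p * v f"
    and "v (\<lambda>x. c * f x) = c * v f"
  using assms unfolding tangent_space_def by auto

lemma tangent_space_not_smooth: "v \<in> tangent_space A p \<Longrightarrow> \<not> smooth_at A p f \<Longrightarrow> v f = 0"
  unfolding tangent_space_def by auto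

lemma tangent_space_uminus:
  assumes "v \<in> tangent_space A p" "smooth_at A p f"
  shows "v (\<lambda>x. - f x) = - v f"
  using tangent_spaceD(3)[OF assms, of "-1"] by simp

lemma tangent_space_diff:
  assumes A: "smooth_manifold A"
    and v: "v \<in> tangent_space A p" and f: "smooth_at A p f" and h: "smooth_at A p h"
  shows "v (\<lambda>x. f x - h x) = v f - v h"
proof -
  have "smooth_at A p (\<lambda>x. - h x)"
    using h smooth_fun_uminus[OF A] by (auto simp: smooth_at_def)
  from tangent_spaceD(1)[OF v f this] show ?thesis
    by (simp add: tangent_space_uminus[OF v h])
qed

lemma subspace_tangent_space: "subspace (tangent_space A p)"
  unfolding subspace_def tangent_space_def
  by (auto simp: scaleR_fun_def algebra_simps)

text \<open>Apply the Leibniz rule to \<open>f - h = b * (f - h)\<close>, where \<open>b\<close> and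
  \<open>f - h\<close> both vanish at \<open>p\<close>. Smoothness of \<open>h\<close> at
  \<open>p\<close> is inherited from \<open>f\<close> through the agreement near
  \<open>p\<close>.\<close>

lemma tangent_space_local:
  assumes A: "smooth_manifold A" and v: "v \<in> tangent_space A p"
    and f: "smooth_at A p f" and W: "open W" "p \<in> W" "\<And>x. x \<in> W \<Longrightarrow> f x = h x"
  shows "v f = v h"
proof -
  \<comment> \<open>Smoothness at \<open>p\<close> concerns only a neighbourhood of
    \<open>p\<close>, so an indicator can stand in for a bump function.\<close>
  define b :: "'a \<Rightarrow> real" where "b = indicator (- W)"
  obtain S where S: "p \<in> S" "S \<subseteq> W" "smooth_fun A S f"
    using smooth_at_common[OF A f f W(1,2)] by metis
  have Sh: "smooth_fun A S h" using smooth_fun_cong[OF A S(3)] W(3) S(2) by blast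
  have "smooth_fun A W b"
    by (rule smooth_fun_cong[OF A smooth_fun_const[OF A W(1)]]) (simp add: b_def)
  then have b: "smooth_at A p b" using W(2) by (rule smooth_atI)
  have d: "smooth_at A p (\<lambda>x. f x - h x)"
    using smooth_fun_add[OF S(3) smooth_fun_uminus[OF A Sh]] S(1) by (auto intro: smooth_atI)
  have "(\<lambda>x. f x - h x) = (\<lambda>x. b x * (f x - h x))"
    using W(3) by (intro ext) (auto simp: b_def indicator_def)
  then have "v (\<lambda>x. f x - h x) = v (\<lambda>x. b x * (f x - h x))" by simp
  also have "\<dots> = 0"
    using tangent_spaceD(2)[OF v b d] W by (simp add: b_def)
  finally show ?thesis
    using tangent_space_diff[OF A v f smooth_atI[OF Sh S(1)]] by simp
qed

section \<open>Smooth vector fields over open sets\<close>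

lemma vfields_tangent: "X \<in> vfields A U \<Longrightarrow> p \<in> U \<Longrightarrow> X p \<in> tangent_space A p"
  by (simp add: vfields_def)

lemma vfields_smooth:
  "X \<in> vfields A U \<Longrightarrow> W \<subseteq> U \<Longrightarrow> smooth_fun A W f \<Longrightarrow> smooth_fun A W (\<lambda>p. X p f)"
  by (simp add: vfields_def)

lemma vfields_mono: "X \<in> vfields A U \<Longrightarrow> W \<subseteq> U \<Longrightarrow> X \<in> vfields A W"
  unfolding vfields_def by blast

lemma vfields_cong:
  assumes "smooth_manifold A" "X \<in> vfields A U" "\<And>p. p \<in> U \<Longrightarrow> X p = Y p"
  shows "Y \<in> vfields A U"
  unfolding vfields_def
proof (intro CollectI conjI ballI allI impI)
  show "Y p \<in> tangent_space A p" if "p \<in> U" for p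
    using assms that vfields_tangent by metis
  show "smooth_fun A W (\<lambda>p. Y p f)" if "W \<subseteq> U" "smooth_fun A W f" for W f
    by (rule smooth_fun_cong[OF assms(1) vfields_smooth[OF assms(2) that]])
      (use that assms(3) in auto)
qed

lemma vfields_add: "X \<in> vfields A U \<Longrightarrow> Y \<in> vfields A U \<Longrightarrow> X + Y \<in> vfields A U"
  unfolding vfields_def by (auto intro: smooth_fun_add subspace_add[OF subspace_tangent_space])

lemma vfields_scale:
  assumes A: "smooth_manifold A" and X: "X \<in> vfields A U" and f: "smooth_fun A U f"
  shows "(\<lambda>q. f q *\<^sub>R X q) \<in> vfields A U"
  unfolding vfields_def
proof (intro CollectI conjI ballI allI impI)
  show "f p *\<^sub>R X p \<in> tangent_space A p" if "p \<in> U" for p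
    using vfields_tangent[OF X that] by (rule subspace_scale[OF subspace_tangent_space])
  show "smooth_fun A W (\<lambda>p. (f p *\<^sub>R X p) h)" if "W \<subseteq> U" "smooth_fun A W h" for W h
    using smooth_fun_mult[OF smooth_fun_subset[OF A f smooth_fun_open[OF that(2)] that(1)]
        vfields_smooth[OF X that]]
    by (simp add: scaleR_fun_def)
qed

lemma vfields_zero: "smooth_manifold A \<Longrightarrow> 0 \<in> vfields A U"
  unfolding vfields_def
  by (auto intro: subspace_0[OF subspace_tangent_space] smooth_fun_const smooth_fun_open)

lemma vfields_uminus:
  assumes A: "smooth_manifold A" and X: "X \<in> vfields A U"
  shows "- X \<in> vfields A U"
  unfolding vfields_def
proof (intro CollectI conjI ballI allI impI)
  show "(- X) p \<in> tangent_space A p" if "p \<in> U" for p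
    using vfields_tangent[OF X that] subspace_neg[OF subspace_tangent_space] by simp
  show "smooth_fun A W (\<lambda>p. (- X) p f)" if "W \<subseteq> U" "smooth_fun A W f" for W f
    using smooth_fun_uminus[OF A vfields_smooth[OF X that]] by simp
qed

text \<open>Fields agreeing on \<open>U\<close> differ by a field that is \<open>b\<close> times
  itself, with \<open>b\<close> zero on \<open>U\<close>; the connection axioms pull
  \<open>b\<close> out.\<close>

lemma nabla_cong:
  assumes A: "smooth_manifold A" and c: "affine_connection A nabla" and U: "open U" "p \<in> U"
    and X: "X \<in> vfields A U" "X' \<in> vfields A U" "\<And>q. q \<in> U \<Longrightarrow> X q = X' q"
    and Y: "Y \<in> vfields A U" "Y' \<in> vfields A U" "\<And>q. q \<in> U \<Longrightarrow> Y q = Y' q"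
  shows "nabla X Y p = nabla X' Y' p"
proof -
  define b :: "'a \<Rightarrow> real" where "b = indicator (- U)"
  have b: "smooth_fun A U b"
    by (rule smooth_fun_cong[OF A smooth_fun_const[OF A U(1)]]) (simp add: b_def)
  have *: "(\<lambda>q. b q *\<^sub>R (Z' - Z) q) = Z' - Z" if "\<And>q. q \<in> U \<Longrightarrow> Z q = Z' q" for Z Z' :: "'a vfield"
    using that by (auto simp: fun_eq_iff b_def indicator_def scaleR_fun_def)
  have diff: "Z' - Z \<in> vfields A U" if "Z \<in> vfields A U" "Z' \<in> vfields A U" for Z Z'
    using vfields_add[OF that(2) vfields_uminus[OF A that(1)]] by simp
  note c' = c[unfolded affine_connection_def, rule_format, OF U(1)]
  have "nabla (\<lambda>q. b q *\<^sub>R (X' - X) q) Y p = 0"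
    using c'[OF diff[OF X(1,2)] Y(1)] b U(2) by (simp add: b_def)
  moreover have "nabla (X + (X' - X)) Y p = nabla X Y p + nabla (X' - X) Y p"
    using c'[OF X(1) Y(1)] diff[OF X(1,2)] U(2) by blast
  ultimately have 1: "nabla X' Y p = nabla X Y p" using *[OF X(3)] by simp
  \<comment> \<open>The Leibniz rule leaves the extra term
    \<open>X' p b *\<^sub>R (Y' - Y) p\<close>, which is zero because the fields agree at
    \<open>p\<close>.\<close>
  have "nabla X' (\<lambda>q. b q *\<^sub>R (Y' - Y) q) p = 0"
    using c'[OF X(2) diff[OF Y(1,2)]] b U(2) Y(3) by (simp add: b_def)
  moreover have "nabla X' (Y + (Y' - Y)) p = nabla X' Y p + nabla X' (Y' - Y) p"
    using c'[OF X(2) Y(1)] diff[OF Y(1,2)] U(2) by blast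
  ultimately have 2: "nabla X' Y' p = nabla X' Y p" using *[OF Y(3)] by simp
  show ?thesis using 1 2 by simp
qed

section \<open>The Levi-Civita connection over an open set\<close>

text \<open>
  Vector fields over \<open>U\<close> are normalised to vanish off \<open>U\<close>, so that two of them agree over \<open>U\<close>
  iff they are equal as functions.
\<close>

definition cut :: "'a set \<Rightarrow> 'a vfield \<Rightarrow> 'a vfield"
  where "cut U X = (\<lambda>p. if p \<in> U then X p else 0)"

locale levi_civita_on =
  fixes A :: "('a::{t2_space,second_countable_topology}, 'e::euclidean_space) atlas"
    and g :: "'a metric" and nabla :: "'a connection" and U :: "'a set"
  assumes A: "smooth_manifold A" and g: "riemannian_metric A g"
    and nabla: "levi_civita A g nabla" and U: "open U"
begin

definition fields :: "'a vfield set"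
  where "fields = {X \<in> vfields A U. \<forall>p. p \<notin> U \<longrightarrow> X p = 0}"

definition covd :: "'a vfield \<Rightarrow> 'a vfield \<Rightarrow> 'a vfield"
  where "covd X Y = cut U (nabla X Y)"

definition ip :: "'a vfield \<Rightarrow> 'a vfield \<Rightarrow> 'a \<Rightarrow> real"
  where "ip X Y = (\<lambda>p. g p (X p) (Y p))"

text \<open>The Lie bracket in its torsion-free form, so that curvature identities reduce to
  additivity of \<open>covd\<close>; \<open>br_eq_lie_bracket\<close> makes the link to
  derivations.\<close>

definition br :: "'a vfield \<Rightarrow> 'a vfield \<Rightarrow> 'a vfield"
  where "br X Y = covd X Y - covd Y X"

definition curv :: "'a vfield \<Rightarrow> 'a vfield \<Rightarrow> 'a vfield \<Rightarrow> 'a vfield"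
  where "curv X Y Z = covd X (covd Y Z) - covd Y (covd X Z) - covd (br X Y) Z"

section \<open>Calculus of the connection on normalised fields\<close>

lemma cut_fields: "X \<in> vfields A U \<Longrightarrow> cut U X \<in> fields"
  using vfields_cong[OF A, of X U "cut U X"] by (simp add: fields_def cut_def)

lemma fields_vfields: "X \<in> fields \<Longrightarrow> X \<in> vfields A U"
  by (simp add: fields_def)

lemma fields_off: "X \<in> fields \<Longrightarrow> p \<notin> U \<Longrightarrow> X p = 0"
  by (simp add: fields_def)

lemma fields_tangent: "X \<in> fields \<Longrightarrow> X p \<in> tangent_space A p"
  by (metis fields_vfields fields_off vfields_tangent subspace_0[OF subspace_tangent_space])

lemma fields_eqI:
  assumes "X \<in> fields" "Y \<in> fields" "\<And>p. p \<in> U \<Longrightarrow> X p = Y p"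
  shows "X = Y"
proof
  show "X p = Y p" for p
    using assms fields_off[of X p] fields_off[of Y p] by (cases "p \<in> U") simp_all
qed

lemma affine: "affine_connection A nabla"
  using nabla by (simp add: levi_civita_def)

lemma covd_apply: "p \<in> U \<Longrightarrow> covd X Y p = nabla X Y p"
  by (simp add: covd_def cut_def)

lemma fields_zero [simp]: "0 \<in> fields"
  by (simp add: fields_def vfields_zero[OF A])

lemma fields_add [simp]: "X \<in> fields \<Longrightarrow> Y \<in> fields \<Longrightarrow> X + Y \<in> fields"
  by (simp add: fields_def vfields_add)

lemma fields_uminus [simp]: "X \<in> fields \<Longrightarrow> - X \<in> fields"
  by (simp add: fields_def vfields_uminus[OF A])

lemma fields_diff [simp]: "X \<in> fields \<Longrightarrow> Y \<in> fields \<Longrightarrow> X - Y \<in> fields"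
  using fields_add[of X "- Y"] by simp

lemma fields_scale [simp]: "X \<in> fields \<Longrightarrow> smooth_fun A U f \<Longrightarrow> (\<lambda>q. f q *\<^sub>R X q) \<in> fields"
  by (simp add: fields_def vfields_scale[OF A])

lemma fields_sum [simp]: "(\<And>i. i \<in> I \<Longrightarrow> X i \<in> fields) \<Longrightarrow> sum X I \<in> fields"
  by (induction I rule: infinite_finite_induct) auto

lemma covd_fields [simp]:
  assumes "X \<in> fields" "Y \<in> fields"
  shows "covd X Y \<in> fields"
proof -
  have "nabla X Y \<in> vfields A U"
    using affine[unfolded affine_connection_def, rule_format, OF U] assms fields_vfields by blast
  then show ?thesis unfolding covd_def by (rule cut_fields)
qed

lemma br_fields [simp]: "X \<in> fields \<Longrightarrow> Y \<in> fields \<Longrightarrow> br X Y \<in> fields"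
  by (simp add: br_def)

lemma curv_fields [simp]: "X \<in> fields \<Longrightarrow> Y \<in> fields \<Longrightarrow> Z \<in> fields \<Longrightarrow> curv X Y Z \<in> fields"
  by (simp add: curv_def)

lemma
  assumes "X \<in> fields" "Y \<in> fields" "Z \<in> fields"
  shows covd_add_left: "covd (X + Z) Y = covd X Y + covd Z Y"
    and covd_add_right: "covd X (Y + Z) = covd X Y + covd X Z"
  using affine[unfolded affine_connection_def, rule_format, OF U,
      OF fields_vfields[OF assms(1)] fields_vfields[OF assms(2)]] fields_vfields[OF assms(3)]
  by (auto simp: covd_def cut_def fun_eq_iff[of "_ :: 'a vfield"])

lemma
  assumes "X \<in> fields" "Y \<in> fields" "smooth_fun A U f"
  shows covd_scale_left: "covd (\<lambda>q. f q *\<^sub>R X q) Y = (\<lambda>q. f q *\<^sub>R covd X Y q)"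
    and covd_scale_right:
      "covd X (\<lambda>q. f q *\<^sub>R Y q) = (\<lambda>q. X q f *\<^sub>R Y q) + (\<lambda>q. f q *\<^sub>R covd X Y q)"
  using affine[unfolded affine_connection_def, rule_format, OF U,
      OF fields_vfields[OF assms(1)] fields_vfields[OF assms(2)]] assms fields_off
  by (auto simp: covd_def cut_def fun_eq_iff[of "_ :: 'a vfield"])

lemma covd_zero_left [simp]: "Y \<in> fields \<Longrightarrow> covd 0 Y = 0"
  using covd_add_left[of 0 Y 0] by simp

lemma covd_zero_right [simp]: "X \<in> fields \<Longrightarrow> covd X 0 = 0"
  using covd_add_right[of X 0 0] by simp

lemma covd_uminus_left: "X \<in> fields \<Longrightarrow> Y \<in> fields \<Longrightarrow> covd (- X) Y = - covd X Y"
  using covd_add_left[of X Y "- X"] by (simp add: eq_neg_iff_add_eq_0 add.commute)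

lemma covd_uminus_right: "X \<in> fields \<Longrightarrow> Y \<in> fields \<Longrightarrow> covd X (- Y) = - covd X Y"
  using covd_add_right[of X Y "- Y"] by (simp add: eq_neg_iff_add_eq_0 add.commute)

lemma covd_diff_left:
  "X \<in> fields \<Longrightarrow> Y \<in> fields \<Longrightarrow> Z \<in> fields \<Longrightarrow> covd (X - Z) Y = covd X Y - covd Z Y"
  using covd_add_left[of X Y "- Z"] by (simp add: covd_uminus_left)

lemma covd_diff_right:
  "X \<in> fields \<Longrightarrow> Y \<in> fields \<Longrightarrow> Z \<in> fields \<Longrightarrow> covd X (Y - Z) = covd X Y - covd X Z"
  using covd_add_right[of X Y "- Z"] by (simp add: covd_uminus_right)

lemma covd_sum_left:
  assumes "\<And>i. i \<in> I \<Longrightarrow> X i \<in> fields" "Y \<in> fields"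
  shows "covd (sum X I) Y = (\<Sum>i\<in>I. covd (X i) Y)"
  using assms by (induction I rule: infinite_finite_induct) (auto simp: covd_add_left)

lemmas covd_linear =
  covd_add_left covd_add_right covd_uminus_left covd_uminus_right covd_diff_left covd_diff_right

section \<open>The metric on fields\<close>

lemma g_lin: "u \<in> tangent_space A p \<Longrightarrow> lin_on (tangent_space A p) (g p u)"
  using g by (simp add: riemannian_metric_def)

lemma ip_commute: "X \<in> fields \<Longrightarrow> Y \<in> fields \<Longrightarrow> ip X Y p = ip Y X p"
  using g fields_tangent[of _ p] by (simp add: riemannian_metric_def ip_def)

lemma ip_add_right: "X \<in> fields \<Longrightarrow> Y \<in> fields \<Longrightarrow> Z \<in> fields \<Longrightarrow> ip X (Y + Z) p = ip X Y p + ip X Z p"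
  using g_lin fields_tangent[of _ p] by (simp add: lin_on_def ip_def)

lemma ip_scale_right:
  "X \<in> fields \<Longrightarrow> Y \<in> fields \<Longrightarrow> ip X (\<lambda>q. f q *\<^sub>R Y q) p = f p * ip X Y p"
  using g_lin fields_tangent[of _ p] by (simp add: lin_on_def ip_def)

lemma ip_uminus_right: "X \<in> fields \<Longrightarrow> Y \<in> fields \<Longrightarrow> ip X (- Y) p = - ip X Y p"
  using ip_scale_right[of X Y "\<lambda>_. -1" p] by (simp add: ip_def)

lemma ip_diff_right: "X \<in> fields \<Longrightarrow> Y \<in> fields \<Longrightarrow> Z \<in> fields \<Longrightarrow> ip X (Y - Z) p = ip X Y p - ip X Z p"
  using ip_add_right[of X Y "- Z"] by (simp add: ip_uminus_right)

lemma ip_zero_right [simp]: "X \<in> fields \<Longrightarrow> ip X 0 p = 0"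
  using ip_add_right[of X 0 0 p] by simp

lemma ip_add_left: "X \<in> fields \<Longrightarrow> Y \<in> fields \<Longrightarrow> Z \<in> fields \<Longrightarrow> ip (Y + Z) X p = ip Y X p + ip Z X p"
  using ip_add_right[of X Y Z p] by (simp add: ip_commute[of X])

lemma ip_diff_left: "X \<in> fields \<Longrightarrow> Y \<in> fields \<Longrightarrow> Z \<in> fields \<Longrightarrow> ip (Y - Z) X p = ip Y X p - ip Z X p"
  using ip_diff_right[of X Y Z p] by (simp add: ip_commute[of X])

lemma ip_uminus_left: "X \<in> fields \<Longrightarrow> Y \<in> fields \<Longrightarrow> ip (- Y) X p = - ip Y X p"
  using ip_uminus_right[of X Y p] by (simp add: ip_commute[of X])

lemma ip_zero_left [simp]: "X \<in> fields \<Longrightarrow> ip 0 X p = 0"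
  using ip_commute[of 0 X] by simp

lemma ip_sum_right:
  "(\<And>i. i \<in> I \<Longrightarrow> X i \<in> fields) \<Longrightarrow> Y \<in> fields \<Longrightarrow> ip Y (sum X I) p = (\<Sum>i\<in>I. ip Y (X i) p)"
  by (induction I rule: infinite_finite_induct) (simp_all add: ip_add_right)

lemmas ip_linear = ip_add_left ip_add_right ip_diff_left ip_diff_right ip_uminus_left ip_uminus_right

lemma ip_pos: "X \<in> fields \<Longrightarrow> X p \<noteq> 0 \<Longrightarrow> ip X X p > 0"
  using g fields_tangent[of X p] by (simp add: riemannian_metric_def ip_def)

lemma fields_eq_zeroI: "X \<in> fields \<Longrightarrow> (\<And>p. p \<in> U \<Longrightarrow> ip X X p = 0) \<Longrightarrow> X = 0"
  by (rule fields_eqI) (auto dest: ip_pos)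

lemma ip_eqI:
  assumes "X \<in> fields" "Y \<in> fields" "\<And>Z p. Z \<in> fields \<Longrightarrow> p \<in> U \<Longrightarrow> ip X Z p = ip Y Z p"
  shows "X = Y"
  using fields_eq_zeroI[of "X - Y"] assms by (simp add: ip_diff_left)

lemma ip_smooth: "X \<in> fields \<Longrightarrow> Y \<in> fields \<Longrightarrow> smooth_fun A U (ip X Y)"
  using g U fields_vfields unfolding riemannian_metric_def ip_def by blast

lemma ip_off: "X \<in> fields \<Longrightarrow> Y \<in> fields \<Longrightarrow> p \<notin> U \<Longrightarrow> ip X Y p = 0"
  using fields_off[of Y p] ip_zero_right[of X p] by (simp add: ip_def)

lemma ip_smooth_at: "X \<in> fields \<Longrightarrow> Y \<in> fields \<Longrightarrow> p \<in> U \<Longrightarrow> smooth_at A p (ip X Y)"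
  using ip_smooth smooth_atI by blast

text \<open>Both sides vanish off \<open>U\<close>, so this can be used as an equation between
  functions and differentiated again.\<close>

lemma metric_compatible:
  assumes "X \<in> fields" "Y \<in> fields" "Z \<in> fields"
  shows "X p (ip Y Z) = ip (covd X Y) Z p + ip Y (covd X Z) p"
proof (cases "p \<in> U")
  case True
  then show ?thesis
    using nabla[unfolded levi_civita_def, THEN conjunct2, rule_format, OF U
        fields_vfields[OF assms(1)] fields_vfields[OF assms(2)] True] fields_vfields[OF assms(3)]
    by (simp add: covd_apply ip_def)
next
  case False
  then show ?thesis using assms fields_off[of X p] by (simp add: ip_off)
qed

section \<open>The bracket as a commutator of derivations\<close>

lemma br_eq_lie_bracket: "X \<in> fields \<Longrightarrow> Y \<in> fields \<Longrightarrow> p \<in> U \<Longrightarrow> br X Y p = lie_bracket A X Y p"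
  using nabla[unfolded levi_civita_def, THEN conjunct2, rule_format, OF U, of X Y p]
    fields_vfields[of X] fields_vfields[of Y]
  by (simp add: br_def covd_apply)

lemma br_apply:
  "X \<in> fields \<Longrightarrow> Y \<in> fields \<Longrightarrow> p \<in> U \<Longrightarrow> smooth_at A p f \<Longrightarrow>
    br X Y p f = X p (\<lambda>q. Y q f) - Y p (\<lambda>q. X q f)"
  by (simp add: br_eq_lie_bracket lie_bracket_def)

lemma field_smooth_at:
  assumes "X \<in> fields" "p \<in> U" "smooth_at A p f"
  shows "smooth_at A p (\<lambda>q. X q f)"
proof -
  obtain W where "p \<in> W" "W \<subseteq> U" "smooth_fun A W f"
    using smooth_at_common[OF A assms(3,3) U assms(2)] by metis
  then show ?thesis using vfields_smooth[OF fields_vfields[OF assms(1)]] smooth_atI by blast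
qed

lemma br_br_apply:
  assumes X: "X \<in> fields" and Y: "Y \<in> fields" and Z: "Z \<in> fields"
    and p: "p \<in> U" and f: "smooth_at A p f"
  shows "br X (br Y Z) p f = X p (\<lambda>q. Y q (\<lambda>r. Z r f)) - X p (\<lambda>q. Z q (\<lambda>r. Y r f))
    - (Y p (\<lambda>q. Z q (\<lambda>r. X r f)) - Z p (\<lambda>q. Y q (\<lambda>r. X r f)))"
proof -
  obtain W where W: "p \<in> W" "W \<subseteq> U" "smooth_fun A W f"
    using smooth_at_common[OF A f f U p] by metis
  note sm = field_smooth_at[OF _ p]
  have "X p (\<lambda>q. br Y Z q f) = X p (\<lambda>q. Y q (\<lambda>r. Z r f) - Z q (\<lambda>r. Y r f))"
  \<comment> \<open>The commutator formula for \<open>br Y Z q f\<close> is available for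
    \<open>q\<close> near \<open>p\<close>, where \<open>f\<close> is smooth; locality of
    \<open>X p\<close> makes this enough.\<close>
  proof (rule tangent_space_local[OF A fields_tangent[OF X] _ smooth_fun_open[OF W(3)] W(1)])
    show "smooth_at A p (\<lambda>q. br Y Z q f)" by (rule sm[OF br_fields[OF Y Z] f])
    fix q assume "q \<in> W"
    then show "br Y Z q f = Y q (\<lambda>r. Z r f) - Z q (\<lambda>r. Y r f)"
      using W by (intro br_apply Y Z) (auto intro: smooth_atI)
  qed
  also have "\<dots> = X p (\<lambda>q. Y q (\<lambda>r. Z r f)) - X p (\<lambda>q. Z q (\<lambda>r. Y r f))"
    by (rule tangent_space_diff[OF A fields_tangent[OF X] sm[OF Y sm[OF Z f]] sm[OF Z sm[OF Y f]]])
  finally show ?thesis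
    using br_apply[OF X br_fields[OF Y Z] p f] br_apply[OF Y Z p sm[OF X f]] by simp
qed

lemma jacobi:
  assumes "X \<in> fields" "Y \<in> fields" "Z \<in> fields"
  shows "br X (br Y Z) + br Y (br Z X) + br Z (br X Y) = 0"
proof (rule fields_eqI)
  fix p assume p: "p \<in> U"
  show "(br X (br Y Z) + br Y (br Z X) + br Z (br X Y)) p = 0 p"
  proof
    fix f
    show "(br X (br Y Z) + br Y (br Z X) + br Z (br X Y)) p f = 0 p f"
    proof (cases "smooth_at A p f")
      case True
      then show ?thesis using assms p by (simp add: br_br_apply)
    next
      case False
      \<comment> \<open>Tangent vectors are zero by convention on functions without a smooth germ at
        \<open>p\<close>.\<close>
      then have "V p f = 0" if "V \<in> fields" for V
        using that by (intro tangent_space_not_smooth[OF fields_tangent])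
      from this[of "br X (br Y Z) + br Y (br Z X) + br Z (br X Y)"] show ?thesis
        using assms by simp
    qed
  qed
qed (use assms in simp_all)

section \<open>Symmetries of the curvature\<close>

lemma bianchi:
  assumes "X \<in> fields" "Y \<in> fields" "Z \<in> fields"
  shows "curv X Y Z + curv Y Z X + curv Z X Y = 0"
proof -
  \<comment> \<open>Since \<open>br\<close> is written with \<open>covd\<close>, the terms regroup
    formally into iterated brackets.\<close>
  have "curv X Y Z + curv Y Z X + curv Z X Y
      = br X (br Y Z) + br Y (br Z X) + br Z (br X Y)"
    using assms by (simp add: curv_def br_def covd_linear algebra_simps)
  then show ?thesis using jacobi[OF assms] by simp
qed

lemma curv_swap: "X \<in> fields \<Longrightarrow> Y \<in> fields \<Longrightarrow> Z \<in> fields \<Longrightarrow> curv Y X Z = - curv X Y Z"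
  by (simp add: curv_def br_def covd_linear algebra_simps)

text \<open>Apply \<open>[X,Y]\<close> to the function \<open>ip Z W\<close> in two ways, as a
  commutator and by metric compatibility; the mixed terms with one derivative on each factor
  cancel.\<close>

lemma curv_skew:
  assumes X: "X \<in> fields" and Y: "Y \<in> fields" and Z: "Z \<in> fields" and W: "W \<in> fields"
    and p: "p \<in> U"
  shows "ip (curv X Y Z) W p = - ip (curv X Y W) Z p"
proof -
  have *: "X p (\<lambda>q. Y q (ip Z W)) = ip (covd X (covd Y Z)) W p + ip (covd Y Z) (covd X W) p
      + (ip (covd X Z) (covd Y W) p + ip Z (covd X (covd Y W)) p)"
    if X: "X \<in> fields" and Y: "Y \<in> fields" for X Y
  proof -
    have "(\<lambda>q. Y q (ip Z W)) = (\<lambda>q. ip (covd Y Z) W q + ip Z (covd Y W) q)"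
      using Y Z W by (simp add: metric_compatible)
    then have "X p (\<lambda>q. Y q (ip Z W)) = X p (ip (covd Y Z) W) + X p (ip Z (covd Y W))"
      using tangent_spaceD(1)[OF fields_tangent[OF X] ip_smooth_at ip_smooth_at] Y Z W p by simp
    then show ?thesis using X Y Z W by (simp add: metric_compatible)
  qed
  have "br X Y p (ip Z W) = X p (\<lambda>q. Y q (ip Z W)) - Y p (\<lambda>q. X q (ip Z W))"
    by (rule br_apply[OF X Y p ip_smooth_at[OF Z W p]])
  moreover have "br X Y p (ip Z W) = ip (covd (br X Y) Z) W p + ip Z (covd (br X Y) W) p"
    using X Y Z W by (simp add: metric_compatible)
  ultimately show ?thesis
    using *[OF X Y] *[OF Y X] X Y Z W
    by (simp add: curv_def ip_linear ip_commute[of _ Z])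
qed

text \<open>The classical octahedron argument: combine the Bianchi identities for the four cyclic
  shifts of \<open>X, Y, Z, W\<close> with skewness in the first and in the last pair.\<close>

lemma curv_pair:
  assumes "X \<in> fields" "Y \<in> fields" "Z \<in> fields" "W \<in> fields" "p \<in> U"
  shows "ip (curv X Y Z) W p = ip (curv Z W X) Y p"
proof -
  have b: "ip (curv X Y Z) W p + ip (curv Y Z X) W p + ip (curv Z X Y) W p = 0"
    if "X \<in> fields" "Y \<in> fields" "Z \<in> fields" "W \<in> fields" for X Y Z W
    using arg_cong[OF bianchi[OF that(1-3)], of "\<lambda>V. ip V W p"] that by (simp add: ip_linear)
  have s: "ip (curv Y X Z) W p = - ip (curv X Y Z) W p"
    if "X \<in> fields" "Y \<in> fields" "Z \<in> fields" "W \<in> fields" for X Y Z W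
    using that by (simp add: curv_swap[of X Y Z] ip_linear)
  note k = curv_skew[OF _ _ _ _ assms(5)]
  show ?thesis
    using b[OF assms(1,2,3,4)] b[OF assms(2,3,4,1)] b[OF assms(3,4,1,2)] b[OF assms(4,1,2,3)]
      k[OF assms(1,2,3,4)] k[OF assms(2,3,1,4)] k[OF assms(3,4,1,2)] k[OF assms(4,1,3,2)]
      k[OF assms(3,1,2,4)] s[OF assms(1,3,4,2)] k[OF assms(4,2,3,1)] s[OF assms(2,4,1,3)]
    by linarith
qed

text \<open>Differentiate \<open>ip (S Y) Z = - ip Y (S Z)\<close> along \<open>X\<close>. It serves
  for both \<open>\<theta>\<close> and \<open>H\<close>, giving the skewness of \<open>N X\<close>
  and \<open>K X\<close>.\<close>

lemma deriv_skew:
  assumes S: "\<And>X. X \<in> fields \<Longrightarrow> S X \<in> fields"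
    and skew: "\<And>X Y p. X \<in> fields \<Longrightarrow> Y \<in> fields \<Longrightarrow> ip (S X) Y p = - ip X (S Y) p"
    and X: "X \<in> fields" and Y: "Y \<in> fields" and Z: "Z \<in> fields" and p: "p \<in> U"
  shows "ip (covd X (S Y) - S (covd X Y)) Z p = - ip Y (covd X (S Z) - S (covd X Z)) p"
proof -
  have "X p (ip (S Y) Z) = X p (\<lambda>q. - ip Y (S Z) q)"
    by (rule arg_cong[of _ _ "X p"], rule ext, rule skew[OF Y Z])
  also have "\<dots> = - X p (ip Y (S Z))"
    by (rule tangent_space_uminus[OF fields_tangent[OF X] ip_smooth_at[OF Y S[OF Z] p]])
  finally have "ip (covd X (S Y)) Z p + ip (S Y) (covd X Z) p
      = - (ip (covd X Y) (S Z) p + ip Y (covd X (S Z)) p)"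
    using X Y Z S by (simp add: metric_compatible)
  then show ?thesis
    using X Y Z S skew[of "covd X Y" Z p] skew[of Y "covd X Z" p] by (simp add: ip_linear)
qed

section \<open>Passage from arbitrary local fields to normalised ones\<close>

lemma nabla_vfields:
  "X \<in> vfields A U \<Longrightarrow> Y \<in> vfields A U \<Longrightarrow> nabla X Y \<in> vfields A U"
  using affine[unfolded affine_connection_def, rule_format, OF U] by blast

lemma cut_nabla:
  assumes "X \<in> vfields A U" "Y \<in> vfields A U"
  shows "cut U (nabla X Y) = covd (cut U X) (cut U Y)"
proof -
  have "nabla X Y p = nabla (cut U X) (cut U Y) p" if "p \<in> U" for p
    using assms fields_vfields[OF cut_fields]
    by (intro nabla_cong[OF A affine U that]) (simp_all add: cut_def)
  then show ?thesis by (auto simp: covd_def cut_def)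
qed

lemma nabla_eq_covd:
  "X \<in> vfields A U \<Longrightarrow> Y \<in> vfields A U \<Longrightarrow> p \<in> U \<Longrightarrow> nabla X Y p = covd (cut U X) (cut U Y) p"
  using cut_nabla[of X Y] by (metis cut_def)

lemma curvature_eq_curv:
  assumes X: "X \<in> vfields A U" and Y: "Y \<in> vfields A U" and Z: "Z \<in> vfields A U" and p: "p \<in> U"
  shows "curvature A nabla X Y Z p = curv (cut U X) (cut U Y) (cut U Z) p"
proof -
  have lb: "(nabla X Y - nabla Y X) q = lie_bracket A X Y q" if "q \<in> U" for q
    using nabla X Y that U by (simp add: levi_civita_def)
  have "nabla X Y - nabla Y X \<in> vfields A U"
    using vfields_add[OF nabla_vfields[OF X Y] vfields_uminus[OF A nabla_vfields[OF Y X]]] by simp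
  from vfields_cong[OF A this lb] have v: "lie_bracket A X Y \<in> vfields A U" .
  have "cut U (lie_bracket A X Y) = cut U (nabla X Y) - cut U (nabla Y X)"
    using lb by (auto simp: cut_def fun_eq_iff[of "_ :: 'a vfield"])
  then have b: "cut U (lie_bracket A X Y) = br (cut U X) (cut U Y)"
    using X Y by (simp add: br_def cut_nabla)
  show ?thesis
    using X Y Z p v by (simp add: curvature_def curv_def nabla_eq_covd cut_nabla nabla_vfields b)
qed

text \<open>The difference \<open>W\<close> of the two sides is orthogonal to every frame vector,
  hence to their span, which is the whole tangent space and contains \<open>W\<close>
  itself.\<close>

lemma frame_expansion:
  assumes E: "orthonormal_frame A g (tangent_space A) U I E" and I: "finite I" and X: "X \<in> fields"
  shows "X = (\<Sum>i\<in>I. (\<lambda>q. ip X (cut U (E i)) q *\<^sub>R cut U (E i) q))"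
proof -
  let ?e = "\<lambda>i. cut U (E i)"
  define W where "W = X - (\<Sum>i\<in>I. (\<lambda>q. ip X (?e i) q *\<^sub>R ?e i q))"
  have e: "?e i \<in> fields" if "i \<in> I" for i
    using E that by (intro cut_fields) (simp add: orthonormal_frame_def)
  have s: "(\<Sum>i\<in>I. (\<lambda>q. ip X (?e i) q *\<^sub>R ?e i q)) \<in> fields"
    using e X by (intro fields_sum fields_scale ip_smooth)
  have W: "W \<in> fields" using s X by (simp add: W_def)
  have "ip W W p = 0" if p: "p \<in> U" for p
  proof -
    have *: "ip W (?e j) p = 0" if j: "j \<in> I" for j
    proof -
      have "ip (?e j) (\<Sum>i\<in>I. (\<lambda>q. ip X (?e i) q *\<^sub>R ?e i q)) p
          = (\<Sum>i\<in>I. ip X (?e i) p * ip (?e j) (?e i) p)"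
        using e j X by (simp add: ip_sum_right ip_scale_right ip_smooth)
      moreover have "ip (?e j) (?e i) p = (if j = i then 1 else 0)" if "i \<in> I" for i
        using E that j p by (simp add: orthonormal_frame_def ip_def cut_def)
      ultimately have "ip (?e j) (\<Sum>i\<in>I. (\<lambda>q. ip X (?e i) q *\<^sub>R ?e i q)) p
          = (\<Sum>i\<in>I. ip X (?e i) p * (if j = i then 1 else 0))"
        by (simp cong: sum.cong)
      also have "\<dots> = ip X (?e j) p" using I j by (simp add: if_distrib cong: if_cong)
      finally have "ip (?e j) W p = 0"
        using e[OF j] X s by (simp add: W_def ip_diff_right ip_commute[of "?e j" X])
      then show ?thesis using ip_commute[OF W e[OF j]] by simp
    qed
    define V where "V = {u \<in> tangent_space A p. g p (W p) u = 0}"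
    have "subspace V"
      using g_lin[OF fields_tangent[OF W, of p]] subspace_tangent_space[of A p]
        ip_zero_right[OF W, of p]
      unfolding subspace_def V_def lin_on_def by (auto simp: ip_def)
    moreover have "E i p \<in> V" if "i \<in> I" for i
      using *[OF that] fields_tangent[OF e[OF that], of p] p by (simp add: V_def ip_def cut_def)
    ultimately have "tangent_space A p \<subseteq> V"
      using E p span_minimal[of "(\<lambda>i. E i p) ` I" V]
      by (simp add: orthonormal_frame_def image_subset_iff)
    then have "W p \<in> V" using fields_tangent[OF W, of p] by blast
    then show ?thesis by (simp add: V_def ip_def)
  qed
  then have "W = 0" using W by (intro fields_eq_zeroI)
  then show ?thesis by (simp add: W_def)
qed

end

section \<open>Nearly cosymplectic structures\<close>

lemma sum_fun_apply: "sum X I p = (\<Sum>i\<in>I. X i p)"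
  by (induction I rule: infinite_finite_induct) simp_all

locale nearly_cosymplectic_on =
  fixes A :: "('a::{t2_space,second_countable_topology}, 'e::euclidean_space) atlas"
    and \<theta> :: "'a \<Rightarrow> 'a tvec \<Rightarrow> 'a tvec" and \<xi> :: "'a vfield" and \<eta> :: "'a \<Rightarrow> 'a tvec \<Rightarrow> real"
    and g :: "'a metric" and nabla :: "'a connection" and U :: "'a set"
  assumes nc: "nearly_cosymplectic A \<theta> \<xi> \<eta> g nabla" and open_U: "open U"
begin

sublocale levi_civita_on A g nabla U
  by standard
    (use nc open_U in \<open>simp_all add: nearly_cosymplectic_def almost_contact_metric_def\<close>)

definition Th :: "'a vfield \<Rightarrow> 'a vfield"
  where "Th X = (\<lambda>p. \<theta> p (X p))"

definition xi :: "'a vfield"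
  where "xi = cut U \<xi>"

text \<open>By \<open>\<eta>_eq\<close> this is the component \<open>\<eta>(X) \<xi>\<close>; the
  form with \<open>ip\<close> has smoothness and vanishing off \<open>U\<close> at hand.\<close>

definition vert :: "'a vfield \<Rightarrow> 'a vfield"
  where "vert X = (\<lambda>q. ip xi X q *\<^sub>R xi q)"

definition H :: "'a vfield \<Rightarrow> 'a vfield"
  where "H X = covd X xi"

text \<open>\<open>N X = \<nabla>\<^sub>X \<theta>\<close> and \<open>K X = \<nabla>\<^sub>X H\<close>, so that \<open>K X Y\<close> is the second covariant derivative of \<open>\<xi>\<close>.\<close>

definition N :: "'a vfield \<Rightarrow> 'a vfield \<Rightarrow> 'a vfield"
  where "N X Y = covd X (Th Y) - Th (covd X Y)"

definition K :: "'a vfield \<Rightarrow> 'a vfield \<Rightarrow> 'a vfield"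
  where "K X Y = covd X (H Y) - H (covd X Y)"

section \<open>Algebra of the almost contact structure\<close>

lemma acm: "almost_contact_metric A \<theta> \<xi> \<eta> g"
  using nc by (simp add: nearly_cosymplectic_def)

lemma \<theta>_lin: "lin_on (tangent_space A p) (\<theta> p)"
  using acm by (simp add: almost_contact_metric_def tensor_1_1_def)

lemma \<theta>_zero: "\<theta> p 0 = 0"
  using \<theta>_lin[of p] subspace_0[OF subspace_tangent_space]
  unfolding lin_on_def by (metis scaleR_zero_left)

lemma \<xi>_vfields: "\<xi> \<in> vfields A U"
  using acm by (auto simp: almost_contact_metric_def intro: vfields_mono)

lemma xi_fields [simp]: "xi \<in> fields"
  unfolding xi_def by (rule cut_fields[OF \<xi>_vfields])

lemma \<theta>_vfields: "X \<in> vfields A U \<Longrightarrow> (\<lambda>q. \<theta> q (X q)) \<in> vfields A U"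
  using acm open_U by (simp add: almost_contact_metric_def tensor_1_1_def)

lemma cut_\<theta>: "cut U (\<lambda>q. \<theta> q (X q)) = Th (cut U X)"
  by (auto simp: cut_def Th_def \<theta>_zero)

lemma Th_fields [simp]: "X \<in> fields \<Longrightarrow> Th X \<in> fields"
  using \<theta>_vfields[OF fields_vfields] by (simp add: fields_def Th_def \<theta>_zero)

lemma Th_add: "X \<in> fields \<Longrightarrow> Y \<in> fields \<Longrightarrow> Th (X + Y) = Th X + Th Y"
  using \<theta>_lin fields_tangent by (auto simp: Th_def lin_on_def fun_eq_iff[of "_ :: 'a vfield"])

lemma Th_scale: "X \<in> fields \<Longrightarrow> Th (\<lambda>q. f q *\<^sub>R X q) = (\<lambda>q. f q *\<^sub>R Th X q)"
  using \<theta>_lin fields_tangent by (auto simp: Th_def lin_on_def fun_eq_iff[of "_ :: 'a vfield"])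

lemma Th_zero [simp]: "Th 0 = 0"
  by (auto simp: Th_def \<theta>_zero)

lemma Th_uminus: "X \<in> fields \<Longrightarrow> Th (- X) = - Th X"
  using Th_add[of X "- X"] by (simp add: eq_neg_iff_add_eq_0 add.commute)

lemma Th_diff: "X \<in> fields \<Longrightarrow> Y \<in> fields \<Longrightarrow> Th (X - Y) = Th X - Th Y"
  using Th_add[of X "- Y"] by (simp add: Th_uminus)

lemmas Th_linear = Th_add Th_uminus Th_diff

lemma ip_xi_xi: "p \<in> U \<Longrightarrow> ip xi xi p = 1"
  using acm by (simp add: almost_contact_metric_def ip_def xi_def cut_def)

lemma Th_Th_apply:
  "X \<in> fields \<Longrightarrow> p \<in> U \<Longrightarrow> Th (Th X) p = - X p + \<eta> p (X p) *\<^sub>R xi p"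
  using acm fields_tangent[of X p] by (simp add: almost_contact_metric_def Th_def xi_def cut_def)

lemma ip_Th_Th:
  "X \<in> fields \<Longrightarrow> Y \<in> fields \<Longrightarrow> p \<in> U \<Longrightarrow> ip (Th X) (Th Y) p = ip X Y p - \<eta> p (X p) * \<eta> p (Y p)"
  using acm fields_tangent[of _ p] by (simp add: almost_contact_metric_def Th_def ip_def)

lemma \<eta>_xi: "p \<in> U \<Longrightarrow> \<eta> p (xi p) = 1"
  using acm by (simp add: almost_contact_metric_def xi_def cut_def)

text \<open>Compatibility gives \<open>|\<theta> \<xi>|^2 = 1 - \<eta>(\<xi>)^2 = 0\<close>.\<close>

lemma Th_xi [simp]: "Th xi = 0"
  by (rule fields_eq_zeroI) (simp_all add: ip_Th_Th ip_xi_xi \<eta>_xi)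

lemma \<eta>_eq: "X \<in> fields \<Longrightarrow> p \<in> U \<Longrightarrow> \<eta> p (X p) = ip xi X p"
  using ip_Th_Th[of X xi p] by (simp add: \<eta>_xi ip_commute[of X xi])

lemma vert_fields [simp]: "X \<in> fields \<Longrightarrow> vert X \<in> fields"
  by (simp add: vert_def ip_smooth)

lemma vert_eq_zero: "(\<And>p. ip xi X p = 0) \<Longrightarrow> vert X = 0"
  by (auto simp: vert_def)

lemma Th_vert [simp]: "Th (vert X) = 0"
  by (auto simp: vert_def Th_scale)

lemma Th_Th: "X \<in> fields \<Longrightarrow> Th (Th X) = - X + vert X"
  by (rule fields_eqI) (simp_all add: Th_Th_apply \<eta>_eq, simp add: vert_def)

text \<open>Compute \<open>\<theta>^3 X\<close> in two ways: as \<open>\<theta>\<close> of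
  \<open>\<theta>^2 X\<close> it has no vertical term, as \<open>\<theta>^2\<close> of
  \<open>\<theta> X\<close> it has the vertical term \<open>vert (Th X)\<close>.\<close>

lemma ip_xi_Th [simp]: "X \<in> fields \<Longrightarrow> ip xi (Th X) p = 0"
proof (cases "p \<in> U")
  case True
  assume X: "X \<in> fields"
  have "Th (Th (Th X)) = - Th X" using X by (simp add: Th_Th[OF X] Th_linear)
  with Th_Th[OF Th_fields[OF X]] have "vert (Th X) = 0" by simp
  then have "ip xi (vert (Th X)) p = 0" by simp
  then show ?thesis using X True by (simp add: vert_def ip_scale_right ip_xi_xi)
qed (simp add: ip_off)

text \<open>Use metric compatibility for the pair \<open>Th X\<close>, \<open>Y\<close>, where
  \<open>\<eta>\<close> vanishes on \<open>Th X\<close>, and expand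
  \<open>\<theta>^2 X\<close>.\<close>

lemma Th_skew:
  assumes "X \<in> fields" "Y \<in> fields"
  shows "ip (Th X) Y p = - ip X (Th Y) p"
proof (cases "p \<in> U")
  case True
  have "ip (Th (Th X)) (Th Y) p = ip (Th X) Y p"
    using assms True by (simp add: ip_Th_Th \<eta>_eq)
  moreover have "ip (vert X) (Th Y) p = 0"
    using assms ip_scale_right[of "Th Y" xi "ip xi X" p] ip_commute[of "vert X" "Th Y" p]
      ip_commute[of "Th Y" xi p] by (simp add: vert_def[symmetric])
  ultimately show ?thesis using assms by (simp add: Th_Th ip_linear)
qed (use assms in \<open>simp add: ip_off\<close>)

section \<open>First derivatives of \<xi> and \<theta>\<close>

lemma H_fields [simp]: "X \<in> fields \<Longrightarrow> H X \<in> fields"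
  by (simp add: H_def)

lemma N_fields [simp]: "X \<in> fields \<Longrightarrow> Y \<in> fields \<Longrightarrow> N X Y \<in> fields"
  by (simp add: N_def)

lemma K_fields [simp]: "X \<in> fields \<Longrightarrow> Y \<in> fields \<Longrightarrow> K X Y \<in> fields"
  by (simp add: K_def)

lemma H_zero [simp]: "H 0 = 0"
  by (simp add: H_def)

lemma H_linear:
  "X \<in> fields \<Longrightarrow> Y \<in> fields \<Longrightarrow> H (X + Y) = H X + H Y"
  "X \<in> fields \<Longrightarrow> H (- X) = - H X"
  "X \<in> fields \<Longrightarrow> Y \<in> fields \<Longrightarrow> H (X - Y) = H X - H Y"
  by (simp_all add: H_def covd_linear)

lemma H_scale: "X \<in> fields \<Longrightarrow> smooth_fun A U f \<Longrightarrow> H (\<lambda>q. f q *\<^sub>R X q) = (\<lambda>q. f q *\<^sub>R H X q)"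
  by (simp add: H_def covd_scale_left)

lemma H_sum: "(\<And>i. i \<in> I \<Longrightarrow> X i \<in> fields) \<Longrightarrow> H (sum X I) = (\<Sum>i\<in>I. H (X i))"
  by (simp add: H_def covd_sum_left)

lemma ip_xi_H [simp]:
  assumes X: "X \<in> fields"
  shows "ip xi (H X) p = 0"
proof (cases "p \<in> U")
  case True
  \<comment> \<open>\<open>ip xi xi\<close> is the indicator of \<open>U\<close>, hence idempotent;
    at a point of \<open>U\<close> the Leibniz rule makes its derivative equal to twice itself, so
    zero.\<close>
  have "(\<lambda>q. ip xi xi q * ip xi xi q) = ip xi xi"
  proof
    show "ip xi xi q * ip xi xi q = ip xi xi q" for q
      by (cases "q \<in> U") (simp_all add: ip_xi_xi ip_off)
  qed
  then have "X p (ip xi xi) = 2 * X p (ip xi xi)"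
    using tangent_spaceD(2)[OF fields_tangent[OF X] ip_smooth_at ip_smooth_at, of xi xi p xi xi] True
    by (simp add: ip_xi_xi)
  then show ?thesis
    using X by (simp add: metric_compatible H_def[symmetric] ip_commute[of "H X"])
qed (use X in \<open>simp add: ip_off\<close>)

lemma covd_Th: "X \<in> fields \<Longrightarrow> Y \<in> fields \<Longrightarrow> covd X (Th Y) = N X Y + Th (covd X Y)"
  by (simp add: N_def)

lemma N_swap:
  assumes "X \<in> fields" "Y \<in> fields"
  shows "N X Y = - N Y X"
proof -
  have "N X Y + N Y X = 0"
  proof (rule fields_eqI)
    show "(N X Y + N Y X) p = 0 p" if "p \<in> U" for p
      using nc assms[THEN fields_vfields] that open_U
      by (simp add: nearly_cosymplectic_def N_def nabla_tensor_def covd_apply Th_def)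
  qed (use assms in simp_all)
  then show ?thesis by (rule eq_neg_iff_add_eq_0[THEN iffD2])
qed

lemma N_self [simp]:
  assumes "X \<in> fields"
  shows "N X X = 0"
proof -
  have "N X X + N X X = 0" using N_swap[OF assms assms] by (metis add.right_inverse)
  then show ?thesis by (metis scaleR_2 scaleR_eq_0_iff zero_neq_numeral)
qed

lemma N_diff_left:
  "X \<in> fields \<Longrightarrow> Y \<in> fields \<Longrightarrow> Z \<in> fields \<Longrightarrow> N (X - Y) Z = N X Z - N Y Z"
  by (simp add: N_def covd_linear Th_linear)

lemma N_xi_right: "X \<in> fields \<Longrightarrow> N X xi = - Th (H X)"
  by (simp add: N_def H_def)

lemma N_xi_left: "X \<in> fields \<Longrightarrow> N xi X = Th (H X)"
  using N_swap[of xi X] by (simp add: N_xi_right)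

lemma Th_Th_H: "X \<in> fields \<Longrightarrow> Th (Th (H X)) = - H X"
  by (simp add: Th_Th vert_eq_zero)

text \<open>\<open>N xi xi = 0\<close> gives \<open>Th (H xi) = 0\<close>; a further
  \<open>Th\<close> returns \<open>- H xi\<close>, because \<open>H xi\<close> is orthogonal to
  \<open>xi\<close>.\<close>

lemma H_xi [simp]: "H xi = 0"
  using N_xi_right[of xi] Th_Th_H[of xi] by simp

text \<open>Differentiate \<open>\<theta>^2 = -Id + \<eta> \<otimes> \<xi>\<close> along
  \<open>\<xi>\<close>. The right side is parallel in that direction since \<open>H xi = 0\<close>,
  so \<open>N xi\<close>, which is \<open>Th\<close> after \<open>H\<close>, anticommutes with
  \<open>Th\<close>. The outer \<open>Th\<close> is then removed by \<open>Th_Th_H\<close>.\<close>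

lemma H_Th:
  assumes Y: "Y \<in> fields"
  shows "H (Th Y) = - Th (H Y)"
proof -
  have "xi p (ip xi Y) = ip xi (covd xi Y) p" for p
    using Y by (simp add: metric_compatible H_def[symmetric])
  then have "covd xi (vert Y) = vert (covd xi Y)"
    using Y by (simp add: vert_def covd_scale_right ip_smooth H_def[symmetric])
      (simp add: fun_eq_iff[of "_ :: 'a vfield"])
  then have "N xi (Th Y) + Th (N xi Y) = 0"
    using Y by (simp add: N_def Th_linear) (simp add: Th_Th covd_linear)
  then have "Th (H (Th Y)) = H Y" using Y by (simp add: N_xi_left Th_Th_H)
  then have "Th (Th (H (Th Y))) = Th (H Y)" by simp
  then have "- H (Th Y) = Th (H Y)" using Y by (simp add: Th_Th_H)
  then show ?thesis by (metis minus_minus)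
qed

lemma N_skew:
  "X \<in> fields \<Longrightarrow> Y \<in> fields \<Longrightarrow> Z \<in> fields \<Longrightarrow> p \<in> U \<Longrightarrow> ip (N X Y) Z p = - ip Y (N X Z) p"
  unfolding N_def by (rule deriv_skew) (simp_all add: Th_skew)

text \<open>\<open>N xi\<close>, being a derivative of the skew \<open>\<theta>\<close>, is skew;
  since it is \<open>Th\<close> after \<open>H\<close>, anticommutation transfers skewness to
  \<open>H\<close>. This says that \<open>\<xi>\<close> is Killing.\<close>

lemma H_skew:
  assumes X: "X \<in> fields" and Y: "Y \<in> fields"
  shows "ip (H X) Y p = - ip X (H Y) p"
proof (cases "p \<in> U")
  case True
  have "ip (H X) Y p = ip (Th (H X)) (Th Y) p"
    using X Y Th_skew[of "Th (H X)" Y p] by (simp add: Th_Th_H ip_linear)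
  also have "\<dots> = - ip X (Th (H (Th Y))) p"
    using X Y N_skew[of xi X "Th Y" p] True by (simp add: N_xi_left)
  also have "Th (H (Th Y)) = H Y"
    using Y by (simp add: H_Th Th_linear Th_Th_H)
  finally show ?thesis .
qed (use assms in \<open>simp add: ip_off\<close>)

section \<open>Second derivatives of \<xi> and the curvature\<close>

lemma K_skew:
  "X \<in> fields \<Longrightarrow> Y \<in> fields \<Longrightarrow> Z \<in> fields \<Longrightarrow> p \<in> U \<Longrightarrow> ip (K X Y) Z p = - ip Y (K X Z) p"
  unfolding K_def by (rule deriv_skew) (simp_all add: H_skew)

lemma curv_xi: "X \<in> fields \<Longrightarrow> Y \<in> fields \<Longrightarrow> curv X Y xi = K X Y - K Y X"
  by (simp add: curv_def K_def br_def H_def covd_linear)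

text \<open>Pair the Bianchi identity with \<open>xi\<close>. Each curvature term is minus the sum
  of two consecutive terms of the cyclic sum, so the total is minus twice that sum.\<close>

lemma K_cyclic:
  assumes "X \<in> fields" "Y \<in> fields" "Z \<in> fields" "p \<in> U"
  shows "ip (K X Y) Z p + ip (K Y Z) X p + ip (K Z X) Y p = 0"
proof -
  have *: "ip (curv X Y Z) xi p = - (ip (K X Y) Z p + ip (K Y Z) X p)"
    if "X \<in> fields" "Y \<in> fields" "Z \<in> fields" for X Y Z
    using that assms(4) curv_skew[of X Y Z xi p] K_skew[of Y X Z p]
    by (simp add: curv_xi ip_linear ip_commute[of X])
  have "ip (curv X Y Z + curv Y Z X + curv Z X Y) xi p = 0"
    using assms by (simp add: bianchi)
  then show ?thesis
    using assms by (simp add: ip_add_left *)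
qed

text \<open>Kostant's formula for a Killing field. Pair symmetry moves \<open>xi\<close> into the
  slot where the curvature is the antisymmetrised \<open>K\<close>; skewness and
  \<open>K_cyclic\<close> merge the two terms.\<close>

lemma curv_xi_left:
  assumes Y: "Y \<in> fields" and Z: "Z \<in> fields"
  shows "curv xi Y Z = - K Y Z"
proof (rule ip_eqI)
  fix W p assume W: "W \<in> fields" and p: "p \<in> U"
  have "ip (curv xi Y Z) W p = ip (K Z W) Y p - ip (K W Z) Y p"
    using Y Z W p by (simp add: curv_pair[of xi] curv_xi ip_linear)
  also have "ip (K W Z) Y p = - ip (K W Y) Z p"
    using Y Z W p by (simp add: K_skew[of W Z Y] ip_commute[of Z])
  finally show "ip (curv xi Y Z) W p = ip (- K Y Z) W p"
    using K_cyclic[OF Y Z W p] Y Z W by (simp add: ip_linear)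
qed (use Y Z in simp_all)

text \<open>The Ricci identity for \<open>\<theta>\<close> on the pair \<open>\<xi>, Y\<close>, evaluated at \<open>Y\<close>.\<close>

lemma ricci_identity:
  assumes Y: "Y \<in> fields"
  shows "K Y (Th Y) = Th (K Y Y) + Th (K Y Y) + N Y (H Y) + N Y (H Y)"
proof -
  \<comment> \<open>One second derivative of \<open>\<theta>\<close> vanishes, being the derivative
    of \<open>N Y Y = 0\<close> along \<open>xi\<close>. The other differentiates
    \<open>N xi = Th H\<close> along \<open>Y\<close>, which yields
    \<open>Th (K Y Y) + N Y (H Y)\<close>; the correction \<open>- N (H Y) Y\<close> supplies the
    second \<open>N Y (H Y)\<close>.\<close>
  have "curv xi Y (Th Y) = Th (curv xi Y Y) - Th (K Y Y) - N Y (H Y) - N Y (H Y)"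
    using Y N_swap[of "covd xi Y" Y] N_swap[of "H Y" Y]
    by (simp add: curv_def K_def br_def covd_Th covd_linear Th_linear N_xi_left H_def[symmetric]
        N_diff_left algebra_simps)
  then have "- K Y (Th Y) = - Th (K Y Y) - Th (K Y Y) - N Y (H Y) - N Y (H Y)"
    using Y by (simp add: curv_xi_left Th_linear)
  then show ?thesis by (simp add: algebra_simps)
qed

section \<open>Values of \<open>K Y Y\<close> and \<open>N Y (H Y)\<close>\<close>

lemma K_Th:
  assumes "X \<in> fields" "Y \<in> fields"
  shows "K X (Th Y) = - N X (H Y) - Th (K X Y) - H (N X Y)"
  \<comment> \<open>This differentiates \<open>H (Th Y) = - Th (H Y)\<close> along \<open>X\<close>;
    the term with \<open>H\<close> outside comes from the derivative of \<open>\<theta>\<close>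
    inside \<open>H\<close>.\<close>
  using assms by (simp add: K_def H_Th H_linear covd_linear covd_Th Th_linear algebra_simps)

lemma K_Th_self [simp]:
  assumes Y: "Y \<in> fields"
  shows "K Y (Th Y) = 0"
proof -
  \<comment> \<open>Put \<open>S = Th (K Y Y) + N Y (H Y)\<close>. The Ricci identity gives
    \<open>2 S\<close> and \<open>K_Th\<close> gives \<open>- S\<close>, as
    \<open>N Y Y = 0\<close>; hence \<open>S = 0\<close>. Evaluating at \<open>p\<close> and
    \<open>f\<close> turns this into real arithmetic.\<close>
  have "K Y (Th Y) p f = 0" for p f
    using fun_cong[OF fun_cong[OF ricci_identity[OF Y], of p], of f]
      fun_cong[OF fun_cong[OF K_Th[OF Y Y], of p], of f] Y by simp
  then show ?thesis by (intro ext) simp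
qed

lemma Th_K_self:
  assumes Y: "Y \<in> fields"
  shows "Th (K Y Y) = - N Y (H Y)"
  using K_Th[OF Y Y] Y by (simp add: algebra_simps)

lemma K_xi_right: "X \<in> fields \<Longrightarrow> K X xi = - H (H X)"
  by (simp add: K_def H_def[symmetric])

lemma K_scale_right:
  assumes X: "X \<in> fields" and Y: "Y \<in> fields" and f: "smooth_fun A U f"
  shows "K X (\<lambda>q. f q *\<^sub>R Y q) = (\<lambda>q. f q *\<^sub>R K X Y q)"
proof -
  have "smooth_fun A U (\<lambda>q. X q f)"
    using vfields_smooth[OF fields_vfields[OF X] order_refl f] .
  then show ?thesis
    using assms by (simp add: K_def H_scale covd_scale_right H_linear)
      (simp add: fun_eq_iff[of "_ :: 'a vfield"] scaleR_diff_right)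
qed

text \<open>Put \<open>Th Y\<close> for \<open>Y\<close> in \<open>K_Th_self\<close> and expand
  \<open>\<theta>^2 Y = - Y + \<eta>(Y) \<xi>\<close>; the vertical part is evaluated by
  \<open>K_xi_right\<close>.\<close>

lemma K_Th_left:
  assumes Y: "Y \<in> fields"
  shows "K (Th Y) Y = (\<lambda>q. ip xi Y q *\<^sub>R - H (H (Th Y)) q)"
proof -
  have "K (Th Y) (- Y + vert Y) = 0" using K_Th_self[of "Th Y"] Y by (simp add: Th_Th)
  then have "K (Th Y) Y = K (Th Y) (vert Y)"
    using Y by (simp add: K_def covd_linear H_linear algebra_simps)
  also have "\<dots> = (\<lambda>q. ip xi Y q *\<^sub>R K (Th Y) xi q)"
    using Y by (simp add: vert_def K_scale_right ip_smooth)
  finally show ?thesis using Y by (simp add: K_xi_right)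
qed

lemma N_H_self:
  assumes Y: "Y \<in> fields"
  shows "N Y (H Y) = (\<lambda>q. ip xi Y q *\<^sub>R H (H (Th Y)) q)"
proof (rule ip_eqI)
  show "(\<lambda>q. ip xi Y q *\<^sub>R H (H (Th Y)) q) \<in> fields" using Y by (simp add: ip_smooth)
  fix W p assume W: "W \<in> fields" and p: "p \<in> U"
  \<comment> \<open>Total skewness of \<open>N\<close> exchanges the test field \<open>W\<close>
    with \<open>Y\<close>.\<close>
  have "ip (N Y (H Y)) W p = ip (H Y) (N W Y) p"
    using Y W p N_skew[of Y "H Y" W p] N_swap[of Y W] by (simp add: ip_linear)
  also have "\<dots> = - ip (N W (H Y)) Y p"
    using Y W p N_skew[of W "H Y" Y p] by simp
  finally have 1: "ip (N Y (H Y)) W p = - ip (N W (H Y)) Y p" .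
  \<comment> \<open>Pair \<open>K_Th\<close> for \<open>W\<close>, \<open>Y\<close> with
    \<open>Y\<close>. By skewness only the two quantities of \<open>2\<close> occur, each with
    coefficient two.\<close>
  have "ip (H (N W Y)) Y p = ip (N W (H Y)) Y p"
    using Y W p H_skew[of "N W Y" Y p] N_skew[of W "H Y" Y p] by (simp add: ip_commute[of "N W Y"])
  moreover have "ip (K W (Th Y)) Y p = - ip (K W Y) (Th Y) p"
    using Y W p K_skew[of W "Th Y" Y p] by (simp add: ip_commute[of "Th Y"])
  moreover have "ip (Th (K W Y)) Y p = - ip (K W Y) (Th Y) p"
    using Y W by (simp add: Th_skew)
  ultimately have 2: "ip (N W (H Y)) Y p = ip (K W Y) (Th Y) p"
    using Y W K_Th[of W Y] by (simp add: ip_linear)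
  \<comment> \<open>In the cyclic identity for \<open>Y\<close>, \<open>Th Y\<close>,
    \<open>W\<close> the first term is killed by \<open>K_Th_self\<close>, and
    \<open>K_Th_left\<close> evaluates the second.\<close>
  have "ip (K (Th Y) W) Y p + ip (K W Y) (Th Y) p = 0"
    using K_cyclic[of Y "Th Y" W p] Y W p by simp
  moreover have "ip (K (Th Y) W) Y p = - ip W (K (Th Y) Y) p"
    using Y W p by (simp add: K_skew)
  moreover have "ip W (K (Th Y) Y) p = - (ip xi Y p * ip W (H (H (Th Y))) p)"
    using Y W ip_scale_right[of W "- H (H (Th Y))" "ip xi Y" p] by (simp add: K_Th_left ip_linear)
  ultimately have "ip (N Y (H Y)) W p = ip xi Y p * ip W (H (H (Th Y))) p"
    using 1 2 by simp
  also have "\<dots> = ip (\<lambda>q. ip xi Y q *\<^sub>R H (H (Th Y)) q) W p"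
    using Y W by (simp add: ip_commute[of _ W] ip_smooth ip_scale_right)
  finally show "ip (N Y (H Y)) W p = ip (\<lambda>q. ip xi Y q *\<^sub>R H (H (Th Y)) q) W p" .
qed (use Y in simp)

text \<open>Split \<open>K Y Y\<close> as \<open>vert (K Y Y) - Th (Th (K Y Y))\<close>. The
  vertical part follows from skewness of \<open>K Y\<close> and \<open>K Y xi = - H (H Y)\<close>,
  the other from \<open>Th_K_self\<close> and \<open>N_H_self\<close>.\<close>

lemma K_self:
  assumes Y: "Y \<in> fields"
  shows "K Y Y = - (\<lambda>q. ip xi Y q *\<^sub>R H (H Y) q) - (\<lambda>q. ip (H Y) (H Y) q *\<^sub>R xi q)"
proof -
  have "Th (H (H (Th Y))) = - H (H Y)"
    using Y by (simp add: H_Th H_linear Th_Th_H)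
  then have "Th (Th (K Y Y)) = (\<lambda>q. ip xi Y q *\<^sub>R H (H Y) q)"
    using Y by (simp add: Th_K_self N_H_self Th_linear ip_smooth Th_scale)
      (simp add: fun_eq_iff[of "_ :: 'a vfield"])
  moreover have "ip xi (K Y Y) p = - ip (H Y) (H Y) p" for p
  proof (cases "p \<in> U")
    case True
    then show ?thesis
      using Y K_skew[of Y Y xi p] H_skew[of Y "H Y" p]
      by (simp add: K_xi_right ip_linear ip_commute[of xi "K Y Y"])
  qed (use Y in \<open>simp add: ip_off\<close>)
  then have "vert (K Y Y) = - (\<lambda>q. ip (H Y) (H Y) q *\<^sub>R xi q)"
    by (simp add: vert_def fun_eq_iff[of "_ :: 'a vfield"])
  moreover have "K Y Y = vert (K Y Y) - Th (Th (K Y Y))" using Y by (simp add: Th_Th)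
  ultimately show ?thesis by (metis (no_types, lifting) diff_conv_add_uminus add.commute)
qed

lemma N_H_horizontal:
  assumes "Y \<in> fields" "\<And>p. ip xi Y p = 0"
  shows "N Y (H Y) = 0"
  using assms by (simp add: N_H_self) (simp add: fun_eq_iff[of "_ :: 'a vfield"])

text \<open>The curvature is \<open>K Y (Th Y) - K (Th Y) Y\<close>; the first term is always zero
  and the second carries the factor \<open>\<eta>(Y)\<close>.\<close>

lemma curv_xi_horizontal:
  assumes "Y \<in> fields" "\<And>p. ip xi Y p = 0"
  shows "curv Y (Th Y) xi = 0"
  using assms by (simp add: curv_xi K_Th_left) (simp add: fun_eq_iff[of "_ :: 'a vfield"])

section \<open>The Laplacian of \<xi> in a frame\<close>

lemma rough_laplacian_xi:
  assumes E: "orthonormal_frame A g (tangent_space A) U I E" and I: "finite I" and p: "p \<in> U"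
  shows "rough_laplacian nabla I E \<xi> p = sq_norm_nabla g nabla I E \<xi> p *\<^sub>R \<xi> p"
proof -
  let ?e = "\<lambda>i. cut U (E i)"
  have Ev: "E i \<in> vfields A U" if "i \<in> I" for i
    using E that by (simp add: orthonormal_frame_def)
  have e: "?e i \<in> fields" if "i \<in> I" for i using Ev[OF that] by (rule cut_fields)
  have hess: "hessian nabla (E i) (E i) \<xi> p = K (?e i) (?e i) p" if "i \<in> I" for i
    using Ev[OF that] p \<xi>_vfields
    by (simp add: hessian_def K_def H_def xi_def nabla_eq_covd cut_nabla nabla_vfields)
  have norm: "g p (nabla (E i) \<xi> p) (nabla (E i) \<xi> p) = ip (H (?e i)) (H (?e i)) p"
    if "i \<in> I" for i
    using Ev[OF that] p \<xi>_vfields by (simp add: nabla_eq_covd H_def xi_def ip_def)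
  \<comment> \<open>Expanding \<open>xi\<close> in the frame identifies the trace of the first term
    of \<open>K_self\<close> with \<open>- H (H xi)\<close>, which is zero.\<close>
  have "H (H xi) = H (H (\<Sum>i\<in>I. (\<lambda>q. ip xi (?e i) q *\<^sub>R ?e i q)))"
    using frame_expansion[OF E I xi_fields] by simp
  also have "\<dots> = (\<Sum>i\<in>I. (\<lambda>q. ip xi (?e i) q *\<^sub>R H (H (?e i)) q))"
    using e by (simp add: H_sum H_scale ip_smooth)
  finally have "(\<Sum>i\<in>I. (\<lambda>q. ip xi (?e i) q *\<^sub>R H (H (?e i)) q)) p = 0"
    by simp
  then have z: "(\<Sum>i\<in>I. ip xi (?e i) p *\<^sub>R H (H (?e i)) p) = 0"
    by (simp add: sum_fun_apply)
  have "(\<Sum>i\<in>I. hessian nabla (E i) (E i) \<xi> p)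
      = (\<Sum>i\<in>I. - (ip xi (?e i) p *\<^sub>R H (H (?e i)) p) - ip (H (?e i)) (H (?e i)) p *\<^sub>R xi p)"
    using e by (intro sum.cong refl) (simp add: hess K_self)
  also have "\<dots> = - ((\<Sum>i\<in>I. ip (H (?e i)) (H (?e i)) p) *\<^sub>R xi p)"
    by (simp add: sum_subtractf sum_negf z scaleR_sum_left)
  finally show ?thesis
    using p by (simp add: rough_laplacian_def sq_norm_nabla_def sum_fun_apply norm xi_def cut_def
        cong: sum.cong)
qed

section \<open>Horizontal frames and the structure restricted to them\<close>

lemma Fdist_frame:
  assumes F: "orthonormal_frame A g (Fdist A g \<xi>) U I F" and i: "i \<in> I" and p: "p \<in> U"
  shows "F i p \<in> Fdist A g \<xi> p"
proof -
  have "F i p \<in> span ((\<lambda>i. F i p) ` I)" using i by (intro span_base) simp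
  then show ?thesis using F p by (simp add: orthonormal_frame_def)
qed

lemma frame_horizontal:
  assumes F: "orthonormal_frame A g (Fdist A g \<xi>) U I F" and i: "i \<in> I"
  shows "cut U (F i) \<in> fields" "ip xi (cut U (F i)) p = 0"
proof -
  show f: "cut U (F i) \<in> fields" using F i by (intro cut_fields) (simp add: orthonormal_frame_def)
  show "ip xi (cut U (F i)) p = 0"
  proof (cases "p \<in> U")
    case True
    then show ?thesis
      using Fdist_frame[OF F i True] by (simp add: Fdist_def ip_def xi_def cut_def)
  qed (use f in \<open>simp add: ip_off\<close>)
qed

lemma Fproj_zero: "p \<in> U \<Longrightarrow> Fproj g \<xi> p 0 = 0"
  using ip_zero_right[OF xi_fields, of p] by (simp add: Fproj_def ip_def xi_def cut_def)

lemma Fproj_apply: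
  "p \<in> U \<Longrightarrow> Fproj g \<xi> p (X p) = X p - vert X p"
  by (simp add: Fproj_def vert_def ip_def xi_def cut_def)

text \<open>The full curvature term already vanishes before it is projected.\<close>

lemma curvature_F_frame:
  assumes F: "orthonormal_frame A g (Fdist A g \<xi>) U I F" and i: "i \<in> I" and p: "p \<in> U"
  shows "curvature_F A g \<xi> nabla (F i) (\<lambda>q. \<theta> q (F i q)) \<xi> p = 0"
proof -
  have v: "F i \<in> vfields A U" using F i by (simp add: orthonormal_frame_def)
  have "curvature A nabla (F i) (\<lambda>q. \<theta> q (F i q)) \<xi> p = curv (cut U (F i)) (Th (cut U (F i))) xi p"
    using v \<xi>_vfields p by (simp add: curvature_eq_curv \<theta>_vfields cut_\<theta> xi_def)
  then show ?thesis
    using frame_horizontal[OF F i] p by (simp add: curv_xi_horizontal curvature_F_def Fproj_zero)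
qed

text \<open>Once \<open>N\<close> drops out, both terms of the derivative of \<open>J\<close> equal
  \<open>Th\<close> of the derivative of \<open>H E\<close>: projection fixes the first because
  values of \<open>\<theta>\<close> are horizontal, and \<open>\<theta>\<close> kills the vertical
  part removed in the second.\<close>

lemma nabla_bar_Jrestr_zero:
  assumes E: "E \<in> vfields A U" and N: "N (cut U E) (H (cut U E)) = 0" and p: "p \<in> U"
  shows "nabla_tensor (nabla_bar g \<xi> nabla) (Jrestr A g \<xi> \<theta>) E (nabla E \<xi>) p = 0"
proof -
  let ?e = "cut U E" and ?J = "\<lambda>q. Jrestr A g \<xi> \<theta> q (nabla E \<xi> q)"
  have e: "?e \<in> fields" using E by (rule cut_fields)
  have Hq: "nabla E \<xi> q = H ?e q" if "q \<in> U" for q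
    using E \<xi>_vfields that by (simp add: nabla_eq_covd H_def xi_def)
  \<comment> \<open>\<open>Jrestr\<close> is \<open>undefined\<close> off \<open>Fdist\<close>, so
    it may be replaced by \<open>\<theta>\<close> only after membership is shown.\<close>
  have Fd: "H ?e q \<in> Fdist A g \<xi> q" if "q \<in> U" for q
    using fields_tangent[of "H ?e" q] ip_xi_H[OF e, of q] e that
    by (simp add: Fdist_def ip_def xi_def cut_def)
  have Jq: "Th (H ?e) q = ?J q" if "q \<in> U" for q
    using Fd[OF that] that by (simp add: Jrestr_def Hq Th_def)
  have J: "?J \<in> vfields A U"
    using e by (intro vfields_cong[OF A _ Jq]) (simp add: fields_vfields)
  have cJ: "cut U ?J = Th (H ?e)"
    using Jq e fields_off[of "Th (H ?e)"] by (auto simp: cut_def)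
  have cH: "cut U (nabla E \<xi>) = H ?e"
    using E \<xi>_vfields by (simp add: cut_nabla H_def xi_def)
  let ?Y = "covd ?e (H ?e)"
  have Y: "?Y \<in> fields" using e by simp
  have 1: "nabla_bar g \<xi> nabla E ?J p = Th ?Y p"
  proof -
    have "nabla E ?J p = Th ?Y p"
      using E J p e N by (simp add: nabla_eq_covd cJ covd_Th)
    then show ?thesis
      using p Y Fproj_apply[of p "Th ?Y"] by (simp add: nabla_bar_def vert_eq_zero)
  qed
  have "nabla_bar g \<xi> nabla E (nabla E \<xi>) p = (?Y - vert ?Y) p"
    using E \<xi>_vfields p Fproj_apply[of p ?Y]
    by (simp add: nabla_bar_def nabla_eq_covd nabla_vfields cH)
  \<comment> \<open>The same membership is required of the projected derivative.\<close>
  moreover have "(?Y - vert ?Y) p \<in> Fdist A g \<xi> p"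
  proof -
    have "ip xi (?Y - vert ?Y) p = 0"
      using Y p ip_scale_right[of xi xi "ip xi ?Y" p]
      by (simp add: ip_diff_right vert_def[symmetric] ip_xi_xi)
    then show ?thesis
      using fields_tangent[of "?Y - vert ?Y" p] Y p by (simp add: Fdist_def ip_def xi_def cut_def)
  qed
  ultimately have "Jrestr A g \<xi> \<theta> p (nabla_bar g \<xi> nabla E (nabla E \<xi>) p) = Th (?Y - vert ?Y) p"
    by (simp add: Jrestr_def Th_def)
  then show ?thesis
    using 1 Y by (simp add: nabla_tensor_def Th_linear)
qed

text \<open>This rests on \<open>0\<close> lying in \<open>Fdist\<close>, where
  \<open>restrict\<close> does not return \<open>undefined\<close>.\<close>

lemma Jrestr_zero: "Jrestr A g \<xi> \<theta> p 0 = 0"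
proof -
  have "g p (\<xi> p) 0 = 0"
    using g_lin[of "\<xi> p" p] acm subspace_0[OF subspace_tangent_space, of A p]
      vfields_tangent[of \<xi> A UNIV p]
    unfolding almost_contact_metric_def lin_on_def by (metis UNIV_I scaleR_zero_left)
  then show ?thesis
    using subspace_0[OF subspace_tangent_space, of A p] by (simp add: Jrestr_def Fdist_def \<theta>_zero)
qed

lemma extend_frame:
  fixes F :: "nat \<Rightarrow> 'a vfield"
  assumes F: "orthonormal_frame A g (Fdist A g \<xi>) U {1..m} F"
  shows "orthonormal_frame A g (tangent_space A) U {1..m + 1} (\<lambda>i. if i \<le> m then F i else \<xi>)"
    (is "orthonormal_frame A g _ U _ ?E")
  unfolding orthonormal_frame_def
proof (intro conjI ballI)
  show "open U" by (rule open_U)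
  show v: "?E i \<in> vfields A U" if "i \<in> {1..m + 1}" for i
    using F that \<xi>_vfields by (simp add: orthonormal_frame_def)
  fix p assume p: "p \<in> U"
  have \<xi>T: "\<xi> p \<in> tangent_space A p" using \<xi>_vfields p by (rule vfields_tangent)
  have gF: "g p (\<xi> p) (F i p) = 0" "g p (F i p) (\<xi> p) = 0" if "i \<in> {1..m}" for i
  proof -
    show 1: "g p (\<xi> p) (F i p) = 0" using Fdist_frame[OF F that p] by (simp add: Fdist_def)
    show "g p (F i p) (\<xi> p) = 0"
      using 1 ip_commute[OF frame_horizontal(1)[OF F that] xi_fields, of p] p
      by (simp add: ip_def xi_def cut_def)
  qed
  have g\<xi>: "g p (\<xi> p) (\<xi> p) = 1" using ip_xi_xi[OF p] p by (simp add: ip_def xi_def cut_def)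
  show "g p (?E i p) (?E j p) = (if i = j then 1 else 0)"
    if "i \<in> {1..m + 1}" "j \<in> {1..m + 1}" for i j
    using F gF g\<xi> that p by (auto simp: orthonormal_frame_def)
  have spF: "span ((\<lambda>i. F i p) ` {1..m}) = Fdist A g \<xi> p"
    using F p by (simp add: orthonormal_frame_def)
  show "span ((\<lambda>i. ?E i p) ` {1..m + 1}) = tangent_space A p"
  proof
    show "span ((\<lambda>i. ?E i p) ` {1..m + 1}) \<subseteq> tangent_space A p"
      using v p vfields_tangent by (intro span_minimal subspace_tangent_space) blast
    show "tangent_space A p \<subseteq> span ((\<lambda>i. ?E i p) ` {1..m + 1})"
    proof
      fix u assume u: "u \<in> tangent_space A p"
      \<comment> \<open>The horizontal part of \<open>u\<close>: it is spanned by the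
        \<open>F i\<close>, and the rest is a multiple of the vector with index
        \<open>m + 1\<close>.\<close>
      let ?w = "u - g p (\<xi> p) u *\<^sub>R \<xi> p"
      have sc: "- g p (\<xi> p) u *\<^sub>R \<xi> p \<in> tangent_space A p"
        using \<xi>T by (rule subspace_scale[OF subspace_tangent_space])
      have "g p (\<xi> p) (u + - g p (\<xi> p) u *\<^sub>R \<xi> p) = g p (\<xi> p) u + - g p (\<xi> p) u * g p (\<xi> p) (\<xi> p)"
        using g_lin[OF \<xi>T] u sc \<xi>T unfolding lin_on_def by (metis real_scaleR_def)
      moreover have "u + - g p (\<xi> p) u *\<^sub>R \<xi> p \<in> tangent_space A p"
        using u sc by (rule subspace_add[OF subspace_tangent_space])
      ultimately have "?w \<in> Fdist A g \<xi> p" by (simp add: Fdist_def g\<xi>)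
      then have "?w \<in> span ((\<lambda>i. F i p) ` {1..m})" by (simp only: spF)
      moreover have "(\<lambda>i. F i p) ` {1..m} \<subseteq> (\<lambda>i. ?E i p) ` {1..m + 1}" by force
      ultimately have "?w \<in> span ((\<lambda>i. ?E i p) ` {1..m + 1})"
        using span_mono by blast
      moreover have "\<xi> p \<in> span ((\<lambda>i. ?E i p) ` {1..m + 1})"
        by (intro span_base image_eqI[of _ _ "m + 1"]) auto
      ultimately have "?w + g p (\<xi> p) u *\<^sub>R \<xi> p \<in> span ((\<lambda>i. ?E i p) ` {1..m + 1})"
        by (intro span_add span_scale)
      then show "u \<in> span ((\<lambda>i. ?E i p) ` {1..m + 1})" by simp
    qed
  qed
qed

end

theorem proposition3p4:
  fixes A :: "('a::{t2_space,second_countable_topology}, 'e::euclidean_space) atlas"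
    and \<theta> :: "'a \<Rightarrow> 'a tvec \<Rightarrow> 'a tvec"
    and \<xi> :: "'a vfield"
    and \<eta> :: "'a \<Rightarrow> 'a tvec \<Rightarrow> real"
    and g :: "'a metric"
    and nabla :: "'a connection"
    and n :: nat
  assumes dim: "DIM('e) = 2 * n + 1"
    and nc: "nearly_cosymplectic A \<theta> \<xi> \<eta> g nabla"
  shows "harmonic_unit_vector_field A g nabla \<xi> \<and>
    (\<forall>U (F :: nat \<Rightarrow> 'a vfield). orthonormal_frame A g (Fdist A g \<xi>) U {1..2 * n} F \<longrightarrow>
      (\<forall>p\<in>U.
        (\<Sum>i = 1..2 * n. curvature_F A g \<xi> nabla (F i) (\<lambda>q. \<theta> q (F i q)) \<xi> p) = 0 \<and>
        (let E = (\<lambda>i. if i \<le> 2 * n then F i else \<xi>) in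
          rough_laplacian nabla {1..2 * n + 1} E \<xi> p =
            sq_norm_nabla g nabla {1..2 * n + 1} E \<xi> p *\<^sub>R \<xi> p
            - (1 / 2) *\<^sub>R Jrestr A g \<xi> \<theta> p
                (\<Sum>i = 1..2 * n + 1.
                  nabla_tensor (nabla_bar g \<xi> nabla) (Jrestr A g \<xi> \<theta>) (E i) (nabla (E i) \<xi>) p))))"
proof (intro conjI allI impI ballI)
  have acm: "almost_contact_metric A \<theta> \<xi> \<eta> g"
    using nc by (simp add: nearly_cosymplectic_def)
  \<comment> \<open>Harmonicity quantifies over frames on all open sets, so the locale is
    interpreted anew for the domain of each frame.\<close>
  have lap: "rough_laplacian nabla I E \<xi> p = sq_norm_nabla g nabla I E \<xi> p *\<^sub>R \<xi> p"
    if E: "orthonormal_frame A g (tangent_space A) U I E" and I: "finite I" and p: "p \<in> U"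
    for U p and I :: "nat set" and E
  proof -
    interpret nearly_cosymplectic_on A \<theta> \<xi> \<eta> g nabla U
      by standard (use nc E in \<open>simp_all add: orthonormal_frame_def\<close>)
    show ?thesis using E I p by (rule rough_laplacian_xi)
  qed
  show "harmonic_unit_vector_field A g nabla \<xi>"
    using acm lap by (simp add: harmonic_unit_vector_field_def almost_contact_metric_def)
  fix U and F :: "nat \<Rightarrow> 'a vfield" and p
  assume F: "orthonormal_frame A g (Fdist A g \<xi>) U {1..2 * n} F" and p: "p \<in> U"
  interpret nearly_cosymplectic_on A \<theta> \<xi> \<eta> g nabla U
    by standard (use nc F in \<open>simp_all add: orthonormal_frame_def\<close>)
  show "(\<Sum>i = 1..2 * n. curvature_F A g \<xi> nabla (F i) (\<lambda>q. \<theta> q (F i q)) \<xi> p) = 0"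
    using curvature_F_frame[OF F _ p] by (intro sum.neutral) blast
  define E where "E = (\<lambda>i. if i \<le> 2 * n then F i else \<xi>)"
  have E: "orthonormal_frame A g (tangent_space A) U {1..2 * n + 1} E"
    unfolding E_def by (rule extend_frame[OF F])
  have "nabla_tensor (nabla_bar g \<xi> nabla) (Jrestr A g \<xi> \<theta>) (E i) (nabla (E i) \<xi>) p = 0"
    if i: "i \<in> {1..2 * n + 1}" for i
  proof (rule nabla_bar_Jrestr_zero[OF _ _ p])
    show "E i \<in> vfields A U" using E i by (simp add: orthonormal_frame_def)
    show "N (cut U (E i)) (H (cut U (E i))) = 0"
    proof (cases "i \<le> 2 * n")
      case True
      then have "i \<in> {1..2 * n}" using i by simp
      then show ?thesis
        using N_H_horizontal[OF frame_horizontal[OF F]] True by (simp add: E_def)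
    next
      \<comment> \<open>Here \<open>i = 2 * n + 1\<close>, so \<open>E i = \<xi>\<close> and
        \<open>H xi = 0\<close>.\<close>
      case False
      then show ?thesis by (simp add: E_def xi_def[symmetric] N_def)
    qed
  qed
  \<comment> \<open>The correction term is thus \<open>J\<close> applied to zero, and the second
    equation reduces to harmonicity in the extended frame.\<close>
  then have "(\<Sum>i = 1..2 * n + 1.
      nabla_tensor (nabla_bar g \<xi> nabla) (Jrestr A g \<xi> \<theta>) (E i) (nabla (E i) \<xi>) p) = 0"
    by (intro sum.neutral) blast
  then show "let E = (\<lambda>i. if i \<le> 2 * n then F i else \<xi>) in
      rough_laplacian nabla {1..2 * n + 1} E \<xi> p =
        sq_norm_nabla g nabla {1..2 * n + 1} E \<xi> p *\<^sub>R \<xi> p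
        - (1 / 2) *\<^sub>R Jrestr A g \<xi> \<theta> p
            (\<Sum>i = 1..2 * n + 1.
              nabla_tensor (nabla_bar g \<xi> nabla) (Jrestr A g \<xi> \<theta>) (E i) (nabla (E i) \<xi>) p)"
    using lap[OF E _ p] unfolding Let_def E_def[symmetric] by (simp add: Jrestr_zero)
qed

end
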